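(* Let $E(H,K)\equiv e\to H\xrightarrow{i} G\xrightarrow{\beta} K\to e$ be a center extension of multiplicative Lie algebras. Then there exist the following two exact sequences: $$e\to \mathrm{Aut}^{H,K}(G)\xrightarrow{\,i\,}\mathrm{Aut}^K_H(G)\xrightarrow{\Pi_1} C_1^L\xrightarrow{\chi_1}H^2_{ML(\Gamma)}(K,H),$$ $$e\to \mathrm{Aut}^{H,K}(G)\xrightarrow{\,i\,}\mathrm{Aut}^H(G)\xrightarrow{\Pi_2} C_2^L\xrightarrow{\chi_2}H^2_{ML(\Gamma)}(K,H),$$ where $i$ denotes inclusion, $\Pi_1(\phi)=\alpha$ with $\alpha=\phi|_H$, and $\Pi_2(\phi)=\eta$ with $\eta(x)=\beta(\phi(t(x)))$ for $x\in K$.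
   Context: A multiplicative Lie algebra is a triple $(G,\cdot,\star)$ where $(G,\cdot)$ is a (possibly non-abelian) group with identity $e$ and $\star$ is a binary operation such that for all $x,y,z\in G$, writing ${}^zx=zxz^{-1}$: $x\star x=e$; $x\star(yz)=(x\star y)\cdot{}^y(x\star z)$; $(xy)\star z={}^x(y\star z)\cdot(x\star z)$; $((x\star y)\star{}^yz)((y\star z)\star{}^zx)((z\star x)\star{}^xy)=e$; ${}^z(x\star y)={}^zx\star{}^zy$. Homomorphisms preserve both operations, and $\mathrm{Aut}$ denotes the group of automorphisms of a multiplicative Lie algebra. A center extension $E(H,K)\equiv e\to H\xrightarrow{i} G\xrightarrow{\beta}K\to e$ is a short exact sequence of multiplicative Lie algebras in which $H$ (identified with $i(H)=\ker\beta$) is contained in the group center $Z(G)$ and $a\star b=e$ for all $a,b\in H$. $H$ is an ideal of $G$, so $g\star a\in H$ for $g\in G$, $a\in H$. A transversal is a map $t:K\to G$ with $\beta(t(x))=x$ for all $x\in K$ and $t(e)=e$. The associated maps are $f(x,y)=t(x)t(y)t(xy)^{-1}\in H$, $h(x,y)=(t(x)\star t(y))\,t(x\star y)^{-1}\in H$ and $\Gamma_x\in\mathrm{End}(H)$, $\Gamma_x(a)=t(x)\star a$, for $x,y\in K$, $a\in H$. $\mathrm{End}(H)$ is a multiplicative Lie algebra with $(u\cdot v)(a)=u(a)v(a)$, $(u\star v)(a)=u(v(a))\,v(u(a^{-1}))$, and $\Gamma:K\to\mathrm{End}(H)$ is a homomorphism. Cohomology. For the fixed $\Gamma$, $Z^2_{ML(\Gamma)}(K,H)$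 is the abelian group (under $(f,h,\Gamma)(f',h',\Gamma)=(ff',hh',\Gamma)$) of triples $(f,h,\Gamma)$ (multiplicative center 2-cocycles) with $f,h:K\times K\to H$ such that, writing $c(z,w)=f(z^{-1},zw)^{-1}f(zw,z^{-1})$, for all $x,y,z\in K$: $f(e,x)=f(x,e)=e$; $h(x,x)=h(x,e)=h(e,x)=e$; $f(x,y)f(xy,z)=f(y,z)f(x,yz)$; $c(y,x\star z)\,f(x\star y,{}^y(x\star z))\,h(x,y)h(x,z)=\Gamma_x(f(y,z))\,h(x,yz)$; $c(x,y\star z)\,f({}^x(y\star z),x\star z)\,h(x,z)h(y,z)=\Gamma_z(f(x,y)^{-1})\,h(xy,z)$; $\Gamma_x(c(z,y))\,\Gamma_y(c(z,x)^{-1})\,h({}^zx,{}^zy)=c(z,x\star y)\,h(x,y)$; $\Gamma_{x\star y}(c(y,z))\Gamma_{y\star z}(c(z,x))\Gamma_{z\star x}(c(x,y))\,\Gamma_z(h(x,y)^{-1})\Gamma_x(h(y,z)^{-1})\Gamma_y(h(z,x)^{-1})\,h(x\star y,{}^yz)\,h(y\star z,{}^zx)\,h(z\star x,{}^xy)\,f((x\star y)\star{}^yz,(y\star z)\star{}^zx)\,f(((z\star x)\star{}^xy)^{-1},(z\star x)\star{}^xy)=e$. $B^2_{ML(\Gamma)}(K,H)$ is the subgroup of those triples (2-coboundaries) for which there is a map $\lambda:K\to H$ with $\lambda(e)=e$, $f(x,y)=\lambda(x)\lambda(y)\lambda(xy)^{-1}$ and $h(x,y)=\Gamma_x(\lambda(y))\Gamma_y(\lambda(x)^{-1})\lambda(x\star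 y)^{-1}$ for all $x,y\in K$. $H^2_{ML(\Gamma)}(K,H)=Z^2_{ML(\Gamma)}(K,H)/B^2_{ML(\Gamma)}(K,H)$. Groups and maps. $\mathrm{Aut}^H(G)=\{\phi\in\mathrm{Aut}(G):\phi(a)=a\ \forall a\in H\}$; $\mathrm{Aut}^{H,K}(G)=\{\phi\in\mathrm{Aut}(G):\phi(a)=a\ \forall a\in H,\ \phi(g)g^{-1}\in H\ \forall g\in G\}$; $\mathrm{Aut}^K_H(G)=\{\phi\in\mathrm{Aut}(G):\phi(H)=H,\ \phi(g)g^{-1}\in H\ \forall g\in G\}$. $C_1^L=\{\alpha\in\mathrm{Aut}(H):\alpha\Gamma_x=\Gamma_x\alpha\ \forall x\in K\}$ and $C_2^L=\{\eta\in\mathrm{Aut}(K):\Gamma_{\eta(x)}=\Gamma_x\ \forall x\in K\}$. With $f,h$ the maps associated with the transversal $t$: $\chi_1(\alpha)$ is the class of $(r_\alpha,r'_\alpha,\Gamma)$, where $r_\alpha(x,y)=f(x,y)\alpha(f(x,y))^{-1}$, $r'_\alpha(x,y)=h(x,y)\alpha(h(x,y))^{-1}$; and $\chi_2(\eta)$ is the class of $(r_\eta,r'_\eta,\Gamma)$, where $r_\eta(x,y)=f(\eta(x),\eta(y))f(x,y)^{-1}$, $r'_\eta(x,y)=h(\eta(x),\eta(y))h(x,y)^{-1}$. These maps need not be homomorphisms; $\mathrm{Ker}(\chi_j)$ is the set of elements sent to the trivial class, and exactness at $C_j^L$ means $\mathrm{Im}(\Pi_j)=\mathrm{Ker}(\chi_j)$.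 *)

theory Defs
  imports "HOL-Algebra.Coset" "HOL-Algebra.Bij"
begin

section \<open>Multiplicative Lie algebras\<close>

record 'a mla = "'a monoid" +
  star :: "'a \<Rightarrow> 'a \<Rightarrow> 'a" (infixl \<open>\<star>\<index>\<close> 70)

definition conj_by :: "('a, 'b) monoid_scheme \<Rightarrow> 'a \<Rightarrow> 'a \<Rightarrow> 'a"
  where "conj_by G z x = z \<otimes>\<^bsub>G\<^esub> x \<otimes>\<^bsub>G\<^esub> inv\<^bsub>G\<^esub> z"

locale mult_lie_algebra = group L for L :: "('a, 'm) mla_scheme" (structure) +
  assumes star_closed [intro, simp]:
      "\<lbrakk>x \<in> carrier L; y \<in> carrier L\<rbrakk> \<Longrightarrow> x \<star> y \<in> carrier L"
    and star_self:
      "x \<in> carrier L \<Longrightarrow> x \<star> x = \<one>"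
    and star_mult_right:
      "\<lbrakk>x \<in> carrier L; y \<in> carrier L; z \<in> carrier L\<rbrakk>
        \<Longrightarrow> x \<star> (y \<otimes> z) = (x \<star> y) \<otimes> conj_by L y (x \<star> z)"
    and star_mult_left:
      "\<lbrakk>x \<in> carrier L; y \<in> carrier L; z \<in> carrier L\<rbrakk>
        \<Longrightarrow> (x \<otimes> y) \<star> z = conj_by L x (y \<star> z) \<otimes> (x \<star> z)"
    and star_jacobi:
      "\<lbrakk>x \<in> carrier L; y \<in> carrier L; z \<in> carrier L\<rbrakk>
        \<Longrightarrow> ((x \<star> y) \<star> conj_by L y z) \<otimes> ((y \<star> z) \<star> conj_by L z x)
              \<otimes> ((z \<star> x) \<star> conj_by L x y) = \<one>"
    and star_conj:
      "\<lbrakk>x \<in> carrier L; y \<in> carrier L; z \<in> carrier L\<rbrakk>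
        \<Longrightarrow> conj_by L z (x \<star> y) = conj_by L z x \<star> conj_by L z y"

definition mla_hom :: "('a, 'm) mla_scheme \<Rightarrow> ('b, 'n) mla_scheme \<Rightarrow> ('a \<Rightarrow> 'b) set"
  where "mla_hom L M =
    {\<phi> \<in> hom L M. \<forall>x\<in>carrier L. \<forall>y\<in>carrier L. \<phi> (x \<star>\<^bsub>L\<^esub> y) = \<phi> x \<star>\<^bsub>M\<^esub> \<phi> y}"

text \<open>As for \<^const>\<open>auto\<close>, automorphisms are extensional functions on the carrier.\<close>

definition mla_auto :: "('a, 'm) mla_scheme \<Rightarrow> ('a \<Rightarrow> 'a) set"
  where "mla_auto L = mla_hom L L \<inter> Bij (carrier L)"

definition group_center :: "('a, 'b) monoid_scheme \<Rightarrow> 'a set"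
  where "group_center G =
    {z \<in> carrier G. \<forall>g\<in>carrier G. z \<otimes>\<^bsub>G\<^esub> g = g \<otimes>\<^bsub>G\<^esub> z}"


section \<open>Center extensions\<close>

text \<open>
  The injection \<open>i\<close> is kept explicit: \<open>H\<close> is an arbitrary multiplicative Lie algebra, and
  the identification of \<open>H\<close> with \<open>i(H)\<close> is made below by transporting along \<open>i\<close>.
\<close>

locale center_extension =
  H: mult_lie_algebra H + G: mult_lie_algebra G + K: mult_lie_algebra K
  for H :: "('h, 'l) mla_scheme" and G :: "('g, 'm) mla_scheme" and K :: "('k, 'n) mla_scheme" +
  fixes i :: "'h \<Rightarrow> 'g" and \<beta> :: "'g \<Rightarrow> 'k"
  assumes i_hom: "i \<in> mla_hom H G"
    and i_inj: "inj_on i (carrier H)"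
    and \<beta>_hom: "\<beta> \<in> mla_hom G K"
    and \<beta>_surj: "\<beta> ` carrier G = carrier K"
    and exact: "i ` carrier H = kernel G K \<beta>"
    and central: "i ` carrier H \<subseteq> group_center G"
    and star_trivial: "\<lbrakk>a \<in> carrier H; b \<in> carrier H\<rbrakk> \<Longrightarrow> i a \<star>\<^bsub>G\<^esub> i b = \<one>\<^bsub>G\<^esub>"

definition transversal ::
    "('g, 'm) mla_scheme \<Rightarrow> ('k, 'n) mla_scheme \<Rightarrow> ('g \<Rightarrow> 'k) \<Rightarrow> ('k \<Rightarrow> 'g) \<Rightarrow> bool"
  where "transversal G K \<beta> t \<longleftrightarrow>
    t \<in> carrier K \<rightarrow> carrier G \<and> (\<forall>x\<in>carrier K. \<beta> (t x) = x) \<and> t \<one>\<^bsub>K\<^esub> = \<one>\<^bsub>G\<^esub>"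

text \<open>
  Maps \<open>K \<times> K \<rightarrow> H\<close> are extensional functions on pairs, and \<open>x \<mapsto> \<Gamma>\<^sub>x\<close> is extensional
  in both arguments, so that equality of functions is equality of maps.
\<close>

definition ext_f ::
    "('h, 'l) mla_scheme \<Rightarrow> ('g, 'm) mla_scheme \<Rightarrow> ('k, 'n) mla_scheme
      \<Rightarrow> ('h \<Rightarrow> 'g) \<Rightarrow> ('k \<Rightarrow> 'g) \<Rightarrow> 'k \<times> 'k \<Rightarrow> 'h"
  where "ext_f H G K i t = (\<lambda>(x, y) \<in> carrier K \<times> carrier K.
    inv_into (carrier H) i (t x \<otimes>\<^bsub>G\<^esub> t y \<otimes>\<^bsub>G\<^esub> inv\<^bsub>G\<^esub> (t (x \<otimes>\<^bsub>K\<^esub> y))))"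

definition ext_h ::
    "('h, 'l) mla_scheme \<Rightarrow> ('g, 'm) mla_scheme \<Rightarrow> ('k, 'n) mla_scheme
      \<Rightarrow> ('h \<Rightarrow> 'g) \<Rightarrow> ('k \<Rightarrow> 'g) \<Rightarrow> 'k \<times> 'k \<Rightarrow> 'h"
  where "ext_h H G K i t = (\<lambda>(x, y) \<in> carrier K \<times> carrier K.
    inv_into (carrier H) i ((t x \<star>\<^bsub>G\<^esub> t y) \<otimes>\<^bsub>G\<^esub> inv\<^bsub>G\<^esub> (t (x \<star>\<^bsub>K\<^esub> y))))"

definition ext_Gamma ::
    "('h, 'l) mla_scheme \<Rightarrow> ('g, 'm) mla_scheme \<Rightarrow> ('k, 'n) mla_scheme
      \<Rightarrow> ('h \<Rightarrow> 'g) \<Rightarrow> ('k \<Rightarrow> 'g) \<Rightarrow> 'k \<Rightarrow> 'h \<Rightarrow> 'h"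
  where "ext_Gamma H G K i t = (\<lambda>x \<in> carrier K. \<lambda>a \<in> carrier H.
    inv_into (carrier H) i (t x \<star>\<^bsub>G\<^esub> i a))"


section \<open>Second cohomology\<close>

context
  fixes K :: "('k, 'n) mla_scheme" and H :: "('h, 'l) mla_scheme" (structure)
    and \<Gamma> :: "'k \<Rightarrow> 'h \<Rightarrow> 'h"
begin

definition cocycle_c :: "('k \<times> 'k \<Rightarrow> 'h) \<Rightarrow> 'k \<Rightarrow> 'k \<Rightarrow> 'h"
  where "cocycle_c f z w =
    inv (f (inv\<^bsub>K\<^esub> z, z \<otimes>\<^bsub>K\<^esub> w)) \<otimes> f (z \<otimes>\<^bsub>K\<^esub> w, inv\<^bsub>K\<^esub> z)"

definition center_cocycle :: "('k \<times> 'k \<Rightarrow> 'h) \<Rightarrow> ('k \<times> 'k \<Rightarrow> 'h) \<Rightarrow> bool"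
  where "center_cocycle f h \<longleftrightarrow>
    f \<in> carrier K \<times> carrier K \<rightarrow>\<^sub>E carrier H \<and>
    h \<in> carrier K \<times> carrier K \<rightarrow>\<^sub>E carrier H \<and>
    (\<forall>x\<in>carrier K. f (\<one>\<^bsub>K\<^esub>, x) = \<one> \<and> f (x, \<one>\<^bsub>K\<^esub>) = \<one>) \<and>
    (\<forall>x\<in>carrier K. h (x, x) = \<one> \<and> h (x, \<one>\<^bsub>K\<^esub>) = \<one> \<and> h (\<one>\<^bsub>K\<^esub>, x) = \<one>) \<and>
    (\<forall>x\<in>carrier K. \<forall>y\<in>carrier K. \<forall>z\<in>carrier K.
      f (x, y) \<otimes> f (x \<otimes>\<^bsub>K\<^esub> y, z) = f (y, z) \<otimes> f (x, y \<otimes>\<^bsub>K\<^esub> z)) \<and>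
    (\<forall>x\<in>carrier K. \<forall>y\<in>carrier K. \<forall>z\<in>carrier K.
      cocycle_c f y (x \<star>\<^bsub>K\<^esub> z) \<otimes> f (x \<star>\<^bsub>K\<^esub> y, conj_by K y (x \<star>\<^bsub>K\<^esub> z))
        \<otimes> h (x, y) \<otimes> h (x, z)
      = \<Gamma> x (f (y, z)) \<otimes> h (x, y \<otimes>\<^bsub>K\<^esub> z)) \<and>
    (\<forall>x\<in>carrier K. \<forall>y\<in>carrier K. \<forall>z\<in>carrier K.
      cocycle_c f x (y \<star>\<^bsub>K\<^esub> z) \<otimes> f (conj_by K x (y \<star>\<^bsub>K\<^esub> z), x \<star>\<^bsub>K\<^esub> z)
        \<otimes> h (x, z) \<otimes> h (y, z)
      = \<Gamma> z (inv (f (x, y))) \<otimes> h (x \<otimes>\<^bsub>K\<^esub> y, z)) \<and>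
    (\<forall>x\<in>carrier K. \<forall>y\<in>carrier K. \<forall>z\<in>carrier K.
      \<Gamma> x (cocycle_c f z y) \<otimes> \<Gamma> y (inv (cocycle_c f z x))
        \<otimes> h (conj_by K z x, conj_by K z y)
      = cocycle_c f z (x \<star>\<^bsub>K\<^esub> y) \<otimes> h (x, y)) \<and>
    (\<forall>x\<in>carrier K. \<forall>y\<in>carrier K. \<forall>z\<in>carrier K.
      \<Gamma> (x \<star>\<^bsub>K\<^esub> y) (cocycle_c f y z)
        \<otimes> \<Gamma> (y \<star>\<^bsub>K\<^esub> z) (cocycle_c f z x)
        \<otimes> \<Gamma> (z \<star>\<^bsub>K\<^esub> x) (cocycle_c f x y)
        \<otimes> \<Gamma> z (inv (h (x, y))) \<otimes> \<Gamma> x (inv (h (y, z))) \<otimes> \<Gamma> y (inv (h (z, x)))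
        \<otimes> h (x \<star>\<^bsub>K\<^esub> y, conj_by K y z)
        \<otimes> h (y \<star>\<^bsub>K\<^esub> z, conj_by K z x)
        \<otimes> h (z \<star>\<^bsub>K\<^esub> x, conj_by K x y)
        \<otimes> f ((x \<star>\<^bsub>K\<^esub> y) \<star>\<^bsub>K\<^esub> conj_by K y z, (y \<star>\<^bsub>K\<^esub> z) \<star>\<^bsub>K\<^esub> conj_by K z x)
        \<otimes> f (inv\<^bsub>K\<^esub> ((z \<star>\<^bsub>K\<^esub> x) \<star>\<^bsub>K\<^esub> conj_by K x y), (z \<star>\<^bsub>K\<^esub> x) \<star>\<^bsub>K\<^esub> conj_by K x y)
      = \<one>)"

definition Z2_ML :: "(('k \<times> 'k \<Rightarrow> 'h) \<times> ('k \<times> 'k \<Rightarrow> 'h) \<times> ('k \<Rightarrow> 'h \<Rightarrow> 'h)) monoid"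
  where "Z2_ML =
    \<lparr>carrier = {(f, h, \<Gamma>') | f h \<Gamma>'. \<Gamma>' = \<Gamma> \<and> center_cocycle f h},
     mult = (\<lambda>(f, h, \<Gamma>') (f', h', _).
       (\<lambda>p \<in> carrier K \<times> carrier K. f p \<otimes> f' p,
        \<lambda>p \<in> carrier K \<times> carrier K. h p \<otimes> h' p, \<Gamma>')),
     one = (\<lambda>p \<in> carrier K \<times> carrier K. \<one>, \<lambda>p \<in> carrier K \<times> carrier K. \<one>, \<Gamma>)\<rparr>"

definition B2_ML :: "(('k \<times> 'k \<Rightarrow> 'h) \<times> ('k \<times> 'k \<Rightarrow> 'h) \<times> ('k \<Rightarrow> 'h \<Rightarrow> 'h)) set"
  where "B2_ML =
    {(f, h, \<Gamma>') | f h \<Gamma>'. (f, h, \<Gamma>') \<in> carrier Z2_ML \<and>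
      (\<exists>lam \<in> carrier K \<rightarrow> carrier H. lam \<one>\<^bsub>K\<^esub> = \<one> \<and>
        (\<forall>x\<in>carrier K. \<forall>y\<in>carrier K.
          f (x, y) = lam x \<otimes> lam y \<otimes> inv (lam (x \<otimes>\<^bsub>K\<^esub> y)) \<and>
          h (x, y) = \<Gamma> x (lam y) \<otimes> \<Gamma> y (inv (lam x)) \<otimes> inv (lam (x \<star>\<^bsub>K\<^esub> y))))}"

definition H2_ML :: "(('k \<times> 'k \<Rightarrow> 'h) \<times> ('k \<times> 'k \<Rightarrow> 'h) \<times> ('k \<Rightarrow> 'h \<Rightarrow> 'h)) set monoid"
  where "H2_ML = Z2_ML Mod B2_ML"

definition H2_class ::
    "('k \<times> 'k \<Rightarrow> 'h) \<Rightarrow> ('k \<times> 'k \<Rightarrow> 'h)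
      \<Rightarrow> (('k \<times> 'k \<Rightarrow> 'h) \<times> ('k \<times> 'k \<Rightarrow> 'h) \<times> ('k \<Rightarrow> 'h \<Rightarrow> 'h)) set"
  where "H2_class f h = B2_ML #>\<^bsub>Z2_ML\<^esub> (f, h, \<Gamma>)"

end


section \<open>The groups and maps of the two sequences\<close>

definition Aut_on :: "('a, 'm) mla_scheme \<Rightarrow> (('a \<Rightarrow> 'a) \<Rightarrow> bool) \<Rightarrow> ('a \<Rightarrow> 'a) monoid"
  where "Aut_on L P = BijGroup (carrier L) \<lparr>carrier := {\<phi> \<in> mla_auto L. P \<phi>}\<rparr>"

text \<open>\<open>Aut\<^sup>H(G)\<close>, \<open>Aut\<^sup>H\<^sup>,\<^sup>K(G)\<close> and \<open>Aut\<^sup>K\<^sub>H(G)\<close>, in this order.\<close>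

definition Aut_fix_H ::
    "('h, 'l) mla_scheme \<Rightarrow> ('g, 'm) mla_scheme \<Rightarrow> ('h \<Rightarrow> 'g) \<Rightarrow> ('g \<Rightarrow> 'g) monoid"
  where "Aut_fix_H H G i = Aut_on G (\<lambda>\<phi>. \<forall>a\<in>carrier H. \<phi> (i a) = i a)"

definition Aut_fix_H_K ::
    "('h, 'l) mla_scheme \<Rightarrow> ('g, 'm) mla_scheme \<Rightarrow> ('h \<Rightarrow> 'g) \<Rightarrow> ('g \<Rightarrow> 'g) monoid"
  where "Aut_fix_H_K H G i = Aut_on G (\<lambda>\<phi>.
    (\<forall>a\<in>carrier H. \<phi> (i a) = i a) \<and>
    (\<forall>g\<in>carrier G. \<phi> g \<otimes>\<^bsub>G\<^esub> inv\<^bsub>G\<^esub> g \<in> i ` carrier H))"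

definition Aut_stab_H_fix_K ::
    "('h, 'l) mla_scheme \<Rightarrow> ('g, 'm) mla_scheme \<Rightarrow> ('h \<Rightarrow> 'g) \<Rightarrow> ('g \<Rightarrow> 'g) monoid"
  where "Aut_stab_H_fix_K H G i = Aut_on G (\<lambda>\<phi>.
    \<phi> ` (i ` carrier H) = i ` carrier H \<and>
    (\<forall>g\<in>carrier G. \<phi> g \<otimes>\<^bsub>G\<^esub> inv\<^bsub>G\<^esub> g \<in> i ` carrier H))"

definition C1_L ::
    "('h, 'l) mla_scheme \<Rightarrow> ('k, 'n) mla_scheme \<Rightarrow> ('k \<Rightarrow> 'h \<Rightarrow> 'h) \<Rightarrow> ('h \<Rightarrow> 'h) monoid"
  where "C1_L H K \<Gamma> =
    Aut_on H (\<lambda>\<alpha>. \<forall>x\<in>carrier K. \<forall>a\<in>carrier H. \<alpha> (\<Gamma> x a) = \<Gamma> x (\<alpha> a))"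

definition C2_L ::
    "('h, 'l) mla_scheme \<Rightarrow> ('k, 'n) mla_scheme \<Rightarrow> ('k \<Rightarrow> 'h \<Rightarrow> 'h) \<Rightarrow> ('k \<Rightarrow> 'k) monoid"
  where "C2_L H K \<Gamma> =
    Aut_on K (\<lambda>\<eta>. \<forall>x\<in>carrier K. \<forall>a\<in>carrier H. \<Gamma> (\<eta> x) a = \<Gamma> x a)"

definition Pi1 :: "('h, 'l) mla_scheme \<Rightarrow> ('h \<Rightarrow> 'g) \<Rightarrow> ('g \<Rightarrow> 'g) \<Rightarrow> 'h \<Rightarrow> 'h"
  where "Pi1 H i \<phi> = (\<lambda>a \<in> carrier H. inv_into (carrier H) i (\<phi> (i a)))"

definition Pi2 ::
    "('k, 'n) mla_scheme \<Rightarrow> ('g \<Rightarrow> 'k) \<Rightarrow> ('k \<Rightarrow> 'g) \<Rightarrow> ('g \<Rightarrow> 'g) \<Rightarrow> 'k \<Rightarrow> 'k"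
  where "Pi2 K \<beta> t \<phi> = (\<lambda>x \<in> carrier K. \<beta> (\<phi> (t x)))"

context
  fixes H :: "('h, 'l) mla_scheme" and G :: "('g, 'm) mla_scheme" and K :: "('k, 'n) mla_scheme"
    and i :: "'h \<Rightarrow> 'g" and t :: "'k \<Rightarrow> 'g"
begin

definition chi1 ::
    "('h \<Rightarrow> 'h) \<Rightarrow> (('k \<times> 'k \<Rightarrow> 'h) \<times> ('k \<times> 'k \<Rightarrow> 'h) \<times> ('k \<Rightarrow> 'h \<Rightarrow> 'h)) set"
  where "chi1 \<alpha> = H2_class K H (ext_Gamma H G K i t)
    (\<lambda>p \<in> carrier K \<times> carrier K.
       ext_f H G K i t p \<otimes>\<^bsub>H\<^esub> inv\<^bsub>H\<^esub> (\<alpha> (ext_f H G K i t p)))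
    (\<lambda>p \<in> carrier K \<times> carrier K.
       ext_h H G K i t p \<otimes>\<^bsub>H\<^esub> inv\<^bsub>H\<^esub> (\<alpha> (ext_h H G K i t p)))"

definition chi2 ::
    "('k \<Rightarrow> 'k) \<Rightarrow> (('k \<times> 'k \<Rightarrow> 'h) \<times> ('k \<times> 'k \<Rightarrow> 'h) \<times> ('k \<Rightarrow> 'h \<Rightarrow> 'h)) set"
  where "chi2 \<eta> = H2_class K H (ext_Gamma H G K i t)
    (\<lambda>(x, y) \<in> carrier K \<times> carrier K.
       ext_f H G K i t (\<eta> x, \<eta> y) \<otimes>\<^bsub>H\<^esub> inv\<^bsub>H\<^esub> (ext_f H G K i t (x, y)))
    (\<lambda>(x, y) \<in> carrier K \<times> carrier K.
       ext_h H G K i t (\<eta> x, \<eta> y) \<otimes>\<^bsub>H\<^esub> inv\<^bsub>H\<^esub> (ext_h H G K i t (x, y)))"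

end

text \<open>
  Exactness of \<open>e \<rightarrow> A \<rightarrow> B \<rightarrow> C \<rightarrow> D\<close>, where \<open>\<iota>\<close> and \<open>\<pi>\<close> are group homomorphisms but
  \<open>\<chi>\<close> is only a map between groups; its kernel is the preimage of the identity of \<open>D\<close>.
\<close>

definition exact_sequence ::
    "('a, 'p) monoid_scheme \<Rightarrow> ('a \<Rightarrow> 'b) \<Rightarrow> ('b, 'q) monoid_scheme \<Rightarrow> ('b \<Rightarrow> 'c)
      \<Rightarrow> ('c, 'r) monoid_scheme \<Rightarrow> ('c \<Rightarrow> 'd) \<Rightarrow> ('d, 's) monoid_scheme \<Rightarrow> bool"
  where "exact_sequence A \<iota> B \<pi> C \<chi> D \<longleftrightarrow>
    group_hom A B \<iota> \<and> group_hom B C \<pi> \<and> group D \<and> \<chi> \<in> carrier C \<rightarrow> carrier D \<and>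
    kernel A B \<iota> = {\<one>\<^bsub>A\<^esub>} \<and>
    \<iota> ` carrier A = kernel B C \<pi> \<and>
    \<pi> ` carrier B = kernel C D \<chi>"

end

theory Submission
  imports Defs
begin

text \<open>
  Through the transversal \<open>t\<close> every element of \<open>G\<close> is \<open>i a \<otimes> t x\<close> for unique coordinates
  \<open>a \<in> H\<close> and \<open>x \<in> K\<close>. As \<open>i(H)\<close> is central and \<open>i a \<star> i b\<close> is trivial, the operations of \<open>G\<close>
  read in these coordinates (\<open>elt_mult\<close>, \<open>elt_star\<close>, \<open>elt_conj\<close>)

    \<open>(a, x) \<otimes> (b, y) = (a b f(x, y), x y)\<close>,

    \<open>(a, x) \<star> (b, y) = (\<Gamma>\<^sub>x(b) \<Gamma>\<^sub>y(a)\<^sup>-\<^sup>1 h(x, y), x \<star> y)\<close>,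

  and conjugation by \<open>(a, x)\<close> multiplies the \<open>H\<close>-coordinate of \<open>(b, y)\<close> by \<open>c(x, y)\<close>. The
  identities defining a center cocycle are the axioms of a multiplicative Lie algebra for \<open>G\<close>,
  written for \<open>(\<one>, x)\<close>, \<open>(\<one>, y)\<close>, \<open>(\<one>, z)\<close> and compared in the \<open>H\<close>-coordinate; so \<open>(f, h)\<close> is a
  cocycle (\<open>center_cocycle_ext\<close>).

  Both sequences are cases of one lifting problem. Given \<open>\<alpha> \<in> C\<^sub>1\<close> and \<open>\<eta> \<in> C\<^sub>2\<close>, does some
  automorphism \<open>\<phi>\<close> of \<open>G\<close> restrict to \<open>\<alpha>\<close> on \<open>H\<close> and induce \<open>\<eta>\<close> on \<open>K\<close>? Such a \<open>\<phi>\<close> must have the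
  form \<open>(a, x) \<mapsto> (\<alpha>(a) \<lambda>(x)\<^sup>-\<^sup>1, \<eta>(x))\<close> with \<open>\<lambda>(\<one>) = \<one>\<close>, and in coordinates this map respects the
  two operations exactly if the pair

    \<open>f(\<eta> x, \<eta> y) \<alpha>(f(x, y))\<^sup>-\<^sup>1\<close>, \<open>h(\<eta> x, \<eta> y) \<alpha>(h(x, y))\<^sup>-\<^sup>1\<close>

  is the coboundary of \<open>\<lambda>\<close> (\<open>lifts_if_coboundary\<close>, \<open>coboundary_if_lifts\<close>). Taking \<open>\<eta> = id\<close> gives
  \<open>\<chi>\<^sub>1(\<alpha>)\<close>, taking \<open>\<alpha> = id\<close> gives \<open>\<chi>\<^sub>2(\<eta>)\<close>, and exactness at \<open>C\<^sub>1\<close> and \<open>C\<^sub>2\<close> follows.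

  For \<open>\<chi>\<^sub>1\<close> and \<open>\<chi>\<^sub>2\<close> to take values in the second cohomology group, the displayed pair has to be a
  cocycle. Replacing \<open>i\<close> by \<open>i \<circ> \<alpha>\<^sup>-\<^sup>1\<close>, \<open>\<beta>\<close> by \<open>\<eta>\<^sup>-\<^sup>1 \<circ> \<beta>\<close> and \<open>t\<close> by \<open>t \<circ> \<eta>\<close> gives another center
  extension with the same \<open>\<Gamma>\<close> whose cocycle is \<open>\<alpha>(f(\<eta> x, \<eta> y))\<close>, \<open>\<alpha>(h(\<eta> x, \<eta> y))\<close>
  (\<open>center_cocycle_twisted\<close>), and the displayed pair is a quotient of two such cocycles.
\<close>

section \<open>Multiplicative Lie algebras and their automorphism groups\<close>

context mult_lie_algebra
begin

lemma conj_by_closed [intro, simp]: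
  "\<lbrakk>z \<in> carrier L; x \<in> carrier L\<rbrakk> \<Longrightarrow> conj_by L z x \<in> carrier L"
  by (simp add: conj_by_def)

lemma conj_by_one [simp]: "z \<in> carrier L \<Longrightarrow> conj_by L z \<one> = \<one>"
  by (simp add: conj_by_def)

lemma conj_by_mult:
  "\<lbrakk>z \<in> carrier L; x \<in> carrier L; y \<in> carrier L\<rbrakk>
    \<Longrightarrow> conj_by L z (x \<otimes> y) = conj_by L z x \<otimes> conj_by L z y"
  by (simp add: conj_by_def m_assoc inv_solve_left)

lemma conj_by_eq_iff:
  "\<lbrakk>z \<in> carrier L; x \<in> carrier L; y \<in> carrier L\<rbrakk>
    \<Longrightarrow> conj_by L z x = y \<longleftrightarrow> z \<otimes> x = y \<otimes> z"
  using inv_solve_right' [of y "z \<otimes> x" z] by (simp add: conj_by_def)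

lemma star_one_right [simp]:
  assumes "x \<in> carrier L" shows "x \<star> \<one> = \<one>"
proof -
  have "x \<star> \<one> = (x \<star> \<one>) \<otimes> (x \<star> \<one>)"
    using star_mult_right [of x \<one> \<one>] assms by (simp add: conj_by_def)
  then show ?thesis using assms by simp
qed

lemma star_one_left [simp]:
  assumes "x \<in> carrier L" shows "\<one> \<star> x = \<one>"
proof -
  have "\<one> \<star> x = (\<one> \<star> x) \<otimes> (\<one> \<star> x)"
    using star_mult_left [of \<one> \<one> x] assms by (simp add: conj_by_def)
  then show ?thesis using assms by simp
qed

text \<open>Expanding \<open>(x \<otimes> y) \<star> (x \<otimes> y) = \<one>\<close> leaves a conjugate of \<open>(y \<star> x) \<otimes> (x \<star> y)\<close>.\<close>

lemma star_anticomm: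
  assumes [simp]: "x \<in> carrier L" "y \<in> carrier L"
  shows "y \<star> x = inv (x \<star> y)"
proof -
  have "\<one> = (x \<otimes> y) \<star> (x \<otimes> y)" by (simp add: star_self)
  also have "\<dots> = conj_by L x ((y \<star> x) \<otimes> (x \<star> y))"
    by (simp add: star_mult_left star_mult_right star_self [of x] star_self [of y] conj_by_mult)
  finally have "conj_by L x ((y \<star> x) \<otimes> (x \<star> y)) = \<one>" by (rule sym)
  then have "(y \<star> x) \<otimes> (x \<star> y) = \<one>"
    by (simp add: conj_by_eq_iff)
  then show ?thesis by (simp add: inv_equality)
qed

end

lemma mla_auto_iff:
  "\<phi> \<in> mla_auto L \<longleftrightarrow>
    \<phi> \<in> extensional (carrier L) \<and> bij_betw \<phi> (carrier L) (carrier L) \<and>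
    (\<forall>x\<in>carrier L. \<forall>y\<in>carrier L.
      \<phi> (x \<otimes>\<^bsub>L\<^esub> y) = \<phi> x \<otimes>\<^bsub>L\<^esub> \<phi> y \<and> \<phi> (x \<star>\<^bsub>L\<^esub> y) = \<phi> x \<star>\<^bsub>L\<^esub> \<phi> y)"
  by (auto simp: mla_auto_def mla_hom_def hom_def Bij_def dest: bij_betw_imp_funcset)

lemma mla_auto_closed [intro]:
  "\<lbrakk>\<phi> \<in> mla_auto L; x \<in> carrier L\<rbrakk> \<Longrightarrow> \<phi> x \<in> carrier L"
  by (auto simp: mla_auto_iff bij_betw_def)

lemma mla_auto_inj:
  "\<lbrakk>\<phi> \<in> mla_auto L; x \<in> carrier L; y \<in> carrier L\<rbrakk> \<Longrightarrow> \<phi> x = \<phi> y \<longleftrightarrow> x = y"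
  by (auto simp: mla_auto_iff bij_betw_def inj_on_def)

lemma mla_auto_mult:
  "\<lbrakk>\<phi> \<in> mla_auto L; x \<in> carrier L; y \<in> carrier L\<rbrakk>
    \<Longrightarrow> \<phi> (x \<otimes>\<^bsub>L\<^esub> y) = \<phi> x \<otimes>\<^bsub>L\<^esub> \<phi> y"
  by (simp add: mla_auto_iff)

lemma mla_auto_star:
  "\<lbrakk>\<phi> \<in> mla_auto L; x \<in> carrier L; y \<in> carrier L\<rbrakk>
    \<Longrightarrow> \<phi> (x \<star>\<^bsub>L\<^esub> y) = \<phi> x \<star>\<^bsub>L\<^esub> \<phi> y"
  by (simp add: mla_auto_iff)

context mult_lie_algebra
begin

lemma mla_auto_one [simp]: "\<phi> \<in> mla_auto L \<Longrightarrow> \<phi> \<one> = \<one>"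
  using mla_auto_mult [of \<phi> L \<one> \<one>] mla_auto_closed [of \<phi> L \<one>] by simp

lemma mla_auto_inv:
  assumes "\<phi> \<in> mla_auto L" "x \<in> carrier L"
  shows "\<phi> (inv x) = inv (\<phi> x)"
proof -
  have "\<phi> (inv x) \<otimes> \<phi> x = \<one>"
    using assms by (simp flip: mla_auto_mult)
  then show ?thesis
    using assms by (metis inv_closed inv_equality mla_auto_closed)
qed

lemma mla_auto_id: "(\<lambda>x\<in>carrier L. x) \<in> mla_auto L"
  by (auto simp: mla_auto_iff bij_betw_def inj_on_def)

lemma mla_auto_compose:
  assumes "\<phi> \<in> mla_auto L" "\<psi> \<in> mla_auto L"
  shows "compose (carrier L) \<phi> \<psi> \<in> mla_auto L"
proof -
  have "bij_betw (compose (carrier L) \<phi> \<psi>) (carrier L) (carrier L)"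
    using assms by (auto simp: mla_auto_iff intro: bij_betw_compose)
  moreover have "\<psi> x \<in> carrier L" if "x \<in> carrier L" for x
    using assms(2) that by blast
  ultimately show ?thesis
    using assms by (simp add: mla_auto_iff compose_eq)
qed

lemma mla_auto_inverse_mem:
  assumes "\<phi> \<in> mla_auto L"
  shows "restrict (inv_into (carrier L) \<phi>) (carrier L) \<in> mla_auto L" (is "?\<psi> \<in> _")
    and "\<And>x. x \<in> carrier L \<Longrightarrow> \<phi> (restrict (inv_into (carrier L) \<phi>) (carrier L) x) = x"
    and "\<And>x. x \<in> carrier L \<Longrightarrow> restrict (inv_into (carrier L) \<phi>) (carrier L) (\<phi> x) = x"
proof -
  have bij: "bij_betw \<phi> (carrier L) (carrier L)"
    using assms by (simp add: mla_auto_iff)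
  then show *: "\<phi> (?\<psi> x) = x" if "x \<in> carrier L" for x
    using that by (simp add: bij_betw_inv_into_right)
  show "?\<psi> (\<phi> x) = x" if "x \<in> carrier L" for x
    using that bij assms by (auto simp: bij_betw_inv_into_left)
  have bij': "bij_betw ?\<psi> (carrier L) (carrier L)"
    using bij by (simp add: bij_betw_inv_into)
  then have cl: "?\<psi> x \<in> carrier L" if "x \<in> carrier L" for x
    using that by (rule bij_betw_apply)
  have "?\<psi> (x \<otimes> y) = ?\<psi> x \<otimes> ?\<psi> y \<and> ?\<psi> (x \<star> y) = ?\<psi> x \<star> ?\<psi> y"
    if "x \<in> carrier L" "y \<in> carrier L" for x y
  proof -
    have "\<phi> (?\<psi> (x \<otimes> y)) = \<phi> (?\<psi> x \<otimes> ?\<psi> y)" "\<phi> (?\<psi> (x \<star> y)) = \<phi> (?\<psi> x \<star> ?\<psi> y)"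
      using assms that * cl by (simp_all only: mla_auto_mult mla_auto_star m_closed star_closed)
    then show ?thesis
      by (simp only: mla_auto_inj [OF assms] cl that m_closed star_closed)
  qed
  with bij' show "?\<psi> \<in> mla_auto L"
    unfolding mla_auto_iff by blast
qed

lemma mla_auto_inverse:
  assumes "\<phi> \<in> mla_auto L"
  obtains \<psi> where "\<psi> \<in> mla_auto L"
    and "\<And>x. x \<in> carrier L \<Longrightarrow> \<phi> (\<psi> x) = x" and "\<And>x. x \<in> carrier L \<Longrightarrow> \<psi> (\<phi> x) = x"
  using mla_auto_inverse_mem [OF assms] by blast

lemma group_Aut_on:
  assumes one: "P (\<lambda>x\<in>carrier L. x)"
    and comp: "\<And>\<phi> \<psi>. \<lbrakk>\<phi> \<in> mla_auto L; \<psi> \<in> mla_auto L; P \<phi>; P \<psi>\<rbrakk>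
      \<Longrightarrow> P (compose (carrier L) \<phi> \<psi>)"
    and inverse: "\<And>\<phi> \<psi>. \<lbrakk>\<phi> \<in> mla_auto L; \<psi> \<in> mla_auto L; P \<phi>;
        \<forall>x\<in>carrier L. \<phi> (\<psi> x) = x \<and> \<psi> (\<phi> x) = x\<rbrakk> \<Longrightarrow> P \<psi>"
  shows "group (Aut_on L P)"
proof -
  let ?B = "BijGroup (carrier L)"
  interpret B: group ?B by (rule group_BijGroup)
  have sub: "mla_auto L \<subseteq> Bij (carrier L)" by (auto simp: mla_auto_def)
  have "subgroup {\<phi> \<in> mla_auto L. P \<phi>} ?B"
  proof (rule subgroup.intro)
    show "{\<phi> \<in> mla_auto L. P \<phi>} \<subseteq> carrier ?B"
      using sub by (auto simp: BijGroup_def)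
    show "\<one>\<^bsub>?B\<^esub> \<in> {\<phi> \<in> mla_auto L. P \<phi>}"
      using one mla_auto_id by (simp add: BijGroup_def)
    show "\<phi> \<otimes>\<^bsub>?B\<^esub> \<psi> \<in> {\<phi> \<in> mla_auto L. P \<phi>}"
      if "\<phi> \<in> {\<phi> \<in> mla_auto L. P \<phi>}" "\<psi> \<in> {\<phi> \<in> mla_auto L. P \<phi>}" for \<phi> \<psi>
      using that sub mla_auto_compose comp by (auto simp: BijGroup_def subset_iff)
    show "inv\<^bsub>?B\<^esub> \<phi> \<in> {\<phi> \<in> mla_auto L. P \<phi>}"
      if "\<phi> \<in> {\<phi> \<in> mla_auto L. P \<phi>}" for \<phi>
    proof -
      have "inv\<^bsub>?B\<^esub> \<phi> = restrict (inv_into (carrier L) \<phi>) (carrier L)"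
        using that sub by (auto simp: inv_BijGroup restrict_def)
      with that mla_auto_inverse_mem [of \<phi>] inverse [of \<phi>] show ?thesis by auto
    qed
  qed
  then show ?thesis
    unfolding Aut_on_def by (rule B.subgroup_imp_group)
qed

end

lemma carrier_Aut_on [simp]: "\<phi> \<in> carrier (Aut_on L P) \<longleftrightarrow> \<phi> \<in> mla_auto L \<and> P \<phi>"
  by (simp add: Aut_on_def)

lemma one_Aut_on [simp]: "\<one>\<^bsub>Aut_on L P\<^esub> = (\<lambda>x\<in>carrier L. x)"
  by (simp add: Aut_on_def BijGroup_def)

lemma mult_Aut_on:
  "\<lbrakk>\<phi> \<in> mla_auto L; \<psi> \<in> mla_auto L\<rbrakk> \<Longrightarrow> \<phi> \<otimes>\<^bsub>Aut_on L P\<^esub> \<psi> = compose (carrier L) \<phi> \<psi>"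
  by (simp add: Aut_on_def BijGroup_def mla_auto_def)

section \<open>The second cohomology group\<close>

locale cochains =
  K: mult_lie_algebra K + H: comm_group H
  for K :: "('k, 'n) mla_scheme" and H :: "('h, 'l) mla_scheme" (structure) +
  fixes \<Gamma> :: "'k \<Rightarrow> 'h \<Rightarrow> 'h"
  assumes \<Gamma>_hom: "x \<in> carrier K \<Longrightarrow> \<Gamma> x \<in> hom H H"
begin

lemma \<Gamma>_closed [simp]: "\<lbrakk>x \<in> carrier K; a \<in> carrier H\<rbrakk> \<Longrightarrow> \<Gamma> x a \<in> carrier H"
  using \<Gamma>_hom by (auto simp: hom_def)

lemma \<Gamma>_mult:
  "\<lbrakk>x \<in> carrier K; a \<in> carrier H; b \<in> carrier H\<rbrakk> \<Longrightarrow> \<Gamma> x (a \<otimes> b) = \<Gamma> x a \<otimes> \<Gamma> x b"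
  using \<Gamma>_hom by (auto simp: hom_def)

lemma \<Gamma>_one [simp]: "x \<in> carrier K \<Longrightarrow> \<Gamma> x \<one> = \<one>"
  using \<Gamma>_mult [of x \<one> \<one>] by simp

lemma \<Gamma>_inv: "\<lbrakk>x \<in> carrier K; a \<in> carrier H\<rbrakk> \<Longrightarrow> \<Gamma> x (inv a) = inv (\<Gamma> x a)"
  using \<Gamma>_mult [of x "inv a" a] by (simp add: H.inv_equality)

abbreviation cochain :: "('k \<times> 'k \<Rightarrow> 'h) set"
  where "cochain \<equiv> carrier K \<times> carrier K \<rightarrow>\<^sub>E carrier H"

abbreviation cone :: "'k \<times> 'k \<Rightarrow> 'h"
  where "cone \<equiv> (\<lambda>p\<in>carrier K \<times> carrier K. \<one>)"

abbreviation cmul :: "('k \<times> 'k \<Rightarrow> 'h) \<Rightarrow> ('k \<times> 'k \<Rightarrow> 'h) \<Rightarrow> 'k \<times> 'k \<Rightarrow> 'h"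
  where "cmul f f' \<equiv> (\<lambda>p\<in>carrier K \<times> carrier K. f p \<otimes> f' p)"

abbreviation cinv :: "('k \<times> 'k \<Rightarrow> 'h) \<Rightarrow> 'k \<times> 'k \<Rightarrow> 'h"
  where "cinv f \<equiv> (\<lambda>p\<in>carrier K \<times> carrier K. inv (f p))"

lemma cochain_apply [simp]: "\<lbrakk>f \<in> cochain; x \<in> carrier K; y \<in> carrier K\<rbrakk> \<Longrightarrow> f (x, y) \<in> carrier H"
  by auto

lemma cone_cochain: "cone \<in> cochain"
  by auto

lemma cmul_cochain: "\<lbrakk>f \<in> cochain; f' \<in> cochain\<rbrakk> \<Longrightarrow> cmul f f' \<in> cochain"
  by auto

lemma cinv_cochain: "f \<in> cochain \<Longrightarrow> cinv f \<in> cochain"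
  by auto

text \<open>
  Each cocycle identity equates two expressions built from values of \<open>f\<close> and \<open>h\<close> by products,
  inverses and the endomorphisms \<open>\<Gamma> x\<close>. Such expressions are homomorphisms from the group of
  pairs of cochains to \<open>H\<close>, since \<open>H\<close> is abelian, and the solutions of an identity between
  homomorphisms form a subgroup. These two notions let the group structure of the cocycles be
  read off from the shape of the identities.
\<close>

definition multiplicative :: "(('k \<times> 'k \<Rightarrow> 'h) \<Rightarrow> ('k \<times> 'k \<Rightarrow> 'h) \<Rightarrow> 'h) \<Rightarrow> bool"
  where "multiplicative F \<longleftrightarrow>
    (\<forall>f\<in>cochain. \<forall>h\<in>cochain. F f h \<in> carrier H \<and>
      (\<forall>f'\<in>cochain. \<forall>h'\<in>cochain. F (cmul f f') (cmul h h') = F f h \<otimes> F f' h'))"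

definition subgroup_condition :: "(('k \<times> 'k \<Rightarrow> 'h) \<Rightarrow> ('k \<times> 'k \<Rightarrow> 'h) \<Rightarrow> bool) \<Rightarrow> bool"
  where "subgroup_condition P \<longleftrightarrow>
    P cone cone \<and>
    (\<forall>f\<in>cochain. \<forall>h\<in>cochain. P f h \<longrightarrow> P (cinv f) (cinv h) \<and>
      (\<forall>f'\<in>cochain. \<forall>h'\<in>cochain. P f' h' \<longrightarrow> P (cmul f f') (cmul h h')))"

lemma multiplicative_unit: "multiplicative (\<lambda>f h. \<one>)"
  by (simp add: multiplicative_def)

lemma multiplicative_f: "\<lbrakk>x \<in> carrier K; y \<in> carrier K\<rbrakk> \<Longrightarrow> multiplicative (\<lambda>f h. f (x, y))"
  by (simp add: multiplicative_def)

lemma multiplicative_h: "\<lbrakk>x \<in> carrier K; y \<in> carrier K\<rbrakk> \<Longrightarrow> multiplicative (\<lambda>f h. h (x, y))"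
  by (simp add: multiplicative_def)

lemma multiplicative_mult:
  "\<lbrakk>multiplicative A; multiplicative B\<rbrakk> \<Longrightarrow> multiplicative (\<lambda>f h. A f h \<otimes> B f h)"
  by (simp add: multiplicative_def H.m_ac)

lemma multiplicative_inv:
  "multiplicative A \<Longrightarrow> multiplicative (\<lambda>f h. inv (A f h))"
  by (simp add: multiplicative_def H.inv_mult)

lemma multiplicative_\<Gamma>:
  "\<lbrakk>x \<in> carrier K; multiplicative A\<rbrakk> \<Longrightarrow> multiplicative (\<lambda>f h. \<Gamma> x (A f h))"
  by (simp add: multiplicative_def \<Gamma>_mult)

lemma multiplicative_c:
  "\<lbrakk>z \<in> carrier K; w \<in> carrier K\<rbrakk> \<Longrightarrow> multiplicative (\<lambda>f h. cocycle_c K H f z w)"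
  unfolding cocycle_c_def
  by (intro multiplicative_mult multiplicative_inv multiplicative_f) auto

lemma multiplicative_cone:
  assumes "multiplicative F" shows "F cone cone = \<one>"
proof -
  have "cmul cone cone = cone" by auto
  moreover have "F (cmul cone cone) (cmul cone cone) = F cone cone \<otimes> F cone cone"
    using assms cone_cochain unfolding multiplicative_def by blast
  moreover have "F cone cone \<in> carrier H"
    using assms cone_cochain unfolding multiplicative_def by blast
  ultimately show ?thesis by simp
qed

lemma cmul_cinv: "f \<in> cochain \<Longrightarrow> cmul (cinv f) f = cone"
  by (auto simp: fun_eq_iff PiE_def)

lemma multiplicative_cinv:
  assumes "multiplicative F" "f \<in> cochain" "h \<in> cochain"
  shows "F (cinv f) (cinv h) = inv (F f h)"
proof -
  have "F (cmul (cinv f) f) (cmul (cinv h) h) = F (cinv f) (cinv h) \<otimes> F f h"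
    using assms cinv_cochain unfolding multiplicative_def by blast
  then have "F (cinv f) (cinv h) \<otimes> F f h = \<one>"
    by (simp only: cmul_cinv [OF assms(2)] cmul_cinv [OF assms(3)] multiplicative_cone [OF assms(1)])
  moreover have "F (cinv f) (cinv h) \<in> carrier H" "F f h \<in> carrier H"
    using assms cinv_cochain unfolding multiplicative_def by blast+
  ultimately show ?thesis
    by (intro H.inv_equality [symmetric])
qed

lemma subgroup_condition_eq:
  assumes "multiplicative A" "multiplicative B"
  shows "subgroup_condition (\<lambda>f h. A f h = B f h)"
  unfolding subgroup_condition_def
proof (intro conjI ballI impI)
  show "A cone cone = B cone cone"
    using assms by (simp only: multiplicative_cone)
next
  fix f h assume fh: "f \<in> cochain" "h \<in> cochain" "A f h = B f h"
  then show "A (cinv f) (cinv h) = B (cinv f) (cinv h)"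
    using assms by (simp only: multiplicative_cinv)
  fix f' h' assume "f' \<in> cochain" "h' \<in> cochain" "A f' h' = B f' h'"
  with fh show "A (cmul f f') (cmul h h') = B (cmul f f') (cmul h h')"
    using assms unfolding multiplicative_def by simp
qed

lemma subgroup_condition_ball:
  "(\<And>x. x \<in> X \<Longrightarrow> subgroup_condition (P x)) \<Longrightarrow> subgroup_condition (\<lambda>f h. \<forall>x\<in>X. P x f h)"
  unfolding subgroup_condition_def by blast

lemma subgroup_condition_conj:
  "\<lbrakk>subgroup_condition P; subgroup_condition Q\<rbrakk> \<Longrightarrow> subgroup_condition (\<lambda>f h. P f h \<and> Q f h)"
  unfolding subgroup_condition_def by blast

lemma subgroup_condition_cochain:
  "subgroup_condition (\<lambda>f h. f \<in> cochain)" "subgroup_condition (\<lambda>f h. h \<in> cochain)"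
  unfolding subgroup_condition_def using cone_cochain cmul_cochain cinv_cochain by blast+

text \<open>
  Each clause of the definition is, by its outermost shape, a conjunction, a bounded quantifier or
  an equation between multiplicative expressions.
\<close>

lemma subgroup_condition_center_cocycle: "subgroup_condition (center_cocycle K H \<Gamma>)"
proof -
  have [simp]: "conj_by K y z \<in> carrier K" if "y \<in> carrier K" "z \<in> carrier K" for y z
    using that by blast
  show ?thesis
    unfolding center_cocycle_def
    by (intro subgroup_condition_conj subgroup_condition_cochain subgroup_condition_ball
        subgroup_condition_eq multiplicative_mult multiplicative_inv multiplicative_\<Gamma>
        multiplicative_c multiplicative_f multiplicative_h multiplicative_unit) simp_all
qed

lemma center_cocycle_cochain:
  "center_cocycle K H \<Gamma> f h \<Longrightarrow> f \<in> cochain \<and> h \<in> cochain"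
  by (simp add: center_cocycle_def)

lemma center_cocycle_one: "center_cocycle K H \<Gamma> cone cone"
  using subgroup_condition_center_cocycle unfolding subgroup_condition_def by blast

lemma center_cocycle_mult:
  "\<lbrakk>center_cocycle K H \<Gamma> f h; center_cocycle K H \<Gamma> f' h'\<rbrakk>
    \<Longrightarrow> center_cocycle K H \<Gamma> (cmul f f') (cmul h h')"
  using subgroup_condition_center_cocycle center_cocycle_cochain
  unfolding subgroup_condition_def by blast

lemma center_cocycle_inv:
  "center_cocycle K H \<Gamma> f h \<Longrightarrow> center_cocycle K H \<Gamma> (cinv f) (cinv h)"
  using subgroup_condition_center_cocycle center_cocycle_cochain
  unfolding subgroup_condition_def by blast

lemma carrier_Z2: "(f, h, \<Gamma>') \<in> carrier (Z2_ML K H \<Gamma>) \<longleftrightarrow> \<Gamma>' = \<Gamma> \<and> center_cocycle K H \<Gamma> f h"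
  by (simp add: Z2_ML_def)

lemma Z2_cases:
  assumes "x \<in> carrier (Z2_ML K H \<Gamma>)"
  obtains f h where "x = (f, h, \<Gamma>)" "center_cocycle K H \<Gamma> f h" "f \<in> cochain" "h \<in> cochain"
proof -
  obtain f h where "x = (f, h, \<Gamma>)" "center_cocycle K H \<Gamma> f h"
    using assms unfolding Z2_ML_def by auto
  with that center_cocycle_cochain show ?thesis by blast
qed

lemma mult_Z2: "(f, h, \<Gamma>') \<otimes>\<^bsub>Z2_ML K H \<Gamma>\<^esub> (f', h', \<Gamma>'') = (cmul f f', cmul h h', \<Gamma>')"
  by (simp add: Z2_ML_def)

lemma one_Z2: "\<one>\<^bsub>Z2_ML K H \<Gamma>\<^esub> = (cone, cone, \<Gamma>)"
  by (simp add: Z2_ML_def)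

lemma comm_group_Z2: "comm_group (Z2_ML K H \<Gamma>)"
proof (rule comm_groupI)
  have cmul_assoc: "cmul (cmul f g) h = cmul f (cmul g h)"
    if "f \<in> cochain" "g \<in> cochain" "h \<in> cochain" for f g h
    using that by (intro restrict_ext) (auto simp: H.m_assoc)
  have cmul_comm: "cmul f g = cmul g f" if "f \<in> cochain" "g \<in> cochain" for f g
    using that by (intro restrict_ext) (auto intro!: H.m_comm)
  have cmul_cone: "cmul cone f = f" if "f \<in> cochain" for f
    using that by (intro extensionalityI [of _ "carrier K \<times> carrier K"]) (auto simp: PiE_iff)
  let ?Z = "Z2_ML K H \<Gamma>"
  show "x \<otimes>\<^bsub>?Z\<^esub> y \<in> carrier ?Z" if "x \<in> carrier ?Z" "y \<in> carrier ?Z" for x y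
    using that by (cases x; cases y) (simp only: carrier_Z2 mult_Z2 center_cocycle_mult)
  show "\<one>\<^bsub>?Z\<^esub> \<in> carrier ?Z"
    by (simp only: carrier_Z2 one_Z2 center_cocycle_one)
  show "x \<otimes>\<^bsub>?Z\<^esub> y \<otimes>\<^bsub>?Z\<^esub> z = x \<otimes>\<^bsub>?Z\<^esub> (y \<otimes>\<^bsub>?Z\<^esub> z)"
    if "x \<in> carrier ?Z" "y \<in> carrier ?Z" "z \<in> carrier ?Z" for x y z
    by (rule Z2_cases [OF that(1)]; rule Z2_cases [OF that(2)]; rule Z2_cases [OF that(3)])
      (simp only: mult_Z2 cmul_assoc)
  show "x \<otimes>\<^bsub>?Z\<^esub> y = y \<otimes>\<^bsub>?Z\<^esub> x" if x: "x \<in> carrier ?Z" and y: "y \<in> carrier ?Z" for x y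
  proof -
    obtain f h where x: "x = (f, h, \<Gamma>)" and fh: "f \<in> cochain" "h \<in> cochain"
      using x by (rule Z2_cases)
    obtain f' h' where y: "y = (f', h', \<Gamma>)" and fh': "f' \<in> cochain" "h' \<in> cochain"
      using y by (rule Z2_cases)
    show ?thesis
      by (simp only: x y mult_Z2 cmul_comm [OF fh(1) fh'(1)] cmul_comm [OF fh(2) fh'(2)])
  qed
  show "\<one>\<^bsub>?Z\<^esub> \<otimes>\<^bsub>?Z\<^esub> x = x" if "x \<in> carrier ?Z" for x
    by (rule Z2_cases [OF that]) (simp only: mult_Z2 one_Z2 cmul_cone)
  show "\<exists>y\<in>carrier ?Z. y \<otimes>\<^bsub>?Z\<^esub> x = \<one>\<^bsub>?Z\<^esub>" if x: "x \<in> carrier ?Z" for x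
  proof -
    obtain f h where x: "x = (f, h, \<Gamma>)" and fh: "center_cocycle K H \<Gamma> f h" "f \<in> cochain" "h \<in> cochain"
      using x by (rule Z2_cases)
    have "(cinv f, cinv h, \<Gamma>) \<in> carrier ?Z"
      by (simp only: carrier_Z2 center_cocycle_inv [OF fh(1)])
    moreover have "(cinv f, cinv h, \<Gamma>) \<otimes>\<^bsub>?Z\<^esub> x = \<one>\<^bsub>?Z\<^esub>"
      by (simp only: x mult_Z2 one_Z2 cmul_cinv [OF fh(2)] cmul_cinv [OF fh(3)])
    ultimately show ?thesis by blast
  qed
qed

lemma inv_Z2:
  assumes "center_cocycle K H \<Gamma> f h"
  shows "inv\<^bsub>Z2_ML K H \<Gamma>\<^esub> (f, h, \<Gamma>) = (cinv f, cinv h, \<Gamma>)"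
proof -
  interpret Z: comm_group "Z2_ML K H \<Gamma>" by (rule comm_group_Z2)
  show ?thesis
    by (rule Z.inv_equality)
      (use assms center_cocycle_cochain [OF assms] in
        \<open>simp_all only: carrier_Z2 mult_Z2 one_Z2 cmul_cinv center_cocycle_inv\<close>)
qed

definition coboundary_by :: "('k \<Rightarrow> 'h) \<Rightarrow> ('k \<times> 'k \<Rightarrow> 'h) \<Rightarrow> ('k \<times> 'k \<Rightarrow> 'h) \<Rightarrow> bool"
  where "coboundary_by lam f h \<longleftrightarrow>
    lam \<in> carrier K \<rightarrow> carrier H \<and> lam \<one>\<^bsub>K\<^esub> = \<one> \<and>
    (\<forall>x\<in>carrier K. \<forall>y\<in>carrier K.
      f (x, y) = lam x \<otimes> lam y \<otimes> inv (lam (x \<otimes>\<^bsub>K\<^esub> y)) \<and>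
      h (x, y) = \<Gamma> x (lam y) \<otimes> \<Gamma> y (inv (lam x)) \<otimes> inv (lam (x \<star>\<^bsub>K\<^esub> y)))"

lemma mem_B2:
  "(f, h, \<Gamma>') \<in> B2_ML K H \<Gamma> \<longleftrightarrow>
    \<Gamma>' = \<Gamma> \<and> center_cocycle K H \<Gamma> f h \<and> (\<exists>lam. coboundary_by lam f h)"
  by (auto simp: B2_ML_def carrier_Z2 coboundary_by_def)

lemma B2_cases:
  assumes "x \<in> B2_ML K H \<Gamma>"
  obtains f h lam where "x = (f, h, \<Gamma>)" "center_cocycle K H \<Gamma> f h" "coboundary_by lam f h"
  using assms by (cases x) (auto simp: mem_B2)

lemma coboundary_by_one: "coboundary_by (\<lambda>x. \<one>) cone cone"
  by (simp add: coboundary_by_def)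

lemma coboundary_by_mult:
  "\<lbrakk>coboundary_by lam f h; coboundary_by lam' f' h'\<rbrakk>
    \<Longrightarrow> coboundary_by (\<lambda>x. lam x \<otimes> lam' x) (cmul f f') (cmul h h')"
  by (auto simp: coboundary_by_def Pi_def \<Gamma>_mult H.inv_mult H.m_ac)

lemma coboundary_by_inv:
  "coboundary_by lam f h \<Longrightarrow> coboundary_by (\<lambda>x. inv (lam x)) (cinv f) (cinv h)"
  by (auto simp: coboundary_by_def Pi_def \<Gamma>_inv H.inv_mult H.m_ac)

lemma subgroup_B2: "subgroup (B2_ML K H \<Gamma>) (Z2_ML K H \<Gamma>)"
proof (rule subgroup.intro)
  let ?Z = "Z2_ML K H \<Gamma>" and ?B = "B2_ML K H \<Gamma>"
  show "?B \<subseteq> carrier ?Z" by (auto simp: B2_ML_def)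
  show "\<one>\<^bsub>?Z\<^esub> \<in> ?B"
    using coboundary_by_one center_cocycle_one unfolding one_Z2 mem_B2 by blast
  show "x \<otimes>\<^bsub>?Z\<^esub> y \<in> ?B" if "x \<in> ?B" "y \<in> ?B" for x y
  proof -
    obtain f h lam where x: "x = (f, h, \<Gamma>)"
      and "center_cocycle K H \<Gamma> f h" "coboundary_by lam f h"
      using \<open>x \<in> ?B\<close> by (rule B2_cases)
    moreover obtain f' h' lam' where y: "y = (f', h', \<Gamma>)"
      and "center_cocycle K H \<Gamma> f' h'" "coboundary_by lam' f' h'"
      using \<open>y \<in> ?B\<close> by (rule B2_cases)
    ultimately show ?thesis
      unfolding x y mult_Z2 mem_B2 using coboundary_by_mult center_cocycle_mult by blast
  qed
  show "inv\<^bsub>?Z\<^esub> x \<in> ?B" if x: "x \<in> ?B" for x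
  proof -
    obtain f h lam where x: "x = (f, h, \<Gamma>)"
      and fh: "center_cocycle K H \<Gamma> f h" "coboundary_by lam f h"
      using x by (rule B2_cases)
    then show ?thesis
      unfolding x inv_Z2 [OF fh(1)] mem_B2 using coboundary_by_inv center_cocycle_inv by blast
  qed
qed

lemma group_H2: "group (H2_ML K H \<Gamma>)"
  unfolding H2_ML_def
  using comm_group.subgroup_imp_normal [OF comm_group_Z2 subgroup_B2]
  by (rule normal.factorgroup_is_group)

lemma H2_class_closed:
  assumes "center_cocycle K H \<Gamma> f h"
  shows "H2_class K H \<Gamma> f h \<in> carrier (H2_ML K H \<Gamma>)"
  using assms by (auto simp: H2_class_def H2_ML_def FactGroup_def RCOSETS_def carrier_Z2)

lemma H2_class_trivial_iff:
  assumes "center_cocycle K H \<Gamma> f h"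
  shows "H2_class K H \<Gamma> f h = \<one>\<^bsub>H2_ML K H \<Gamma>\<^esub> \<longleftrightarrow> (\<exists>lam. coboundary_by lam f h)"
proof -
  interpret Z: comm_group "Z2_ML K H \<Gamma>" by (rule comm_group_Z2)
  have "(f, h, \<Gamma>) \<in> carrier (Z2_ML K H \<Gamma>)"
    using assms by (simp add: carrier_Z2)
  then have "H2_class K H \<Gamma> f h = B2_ML K H \<Gamma> \<longleftrightarrow> (f, h, \<Gamma>) \<in> B2_ML K H \<Gamma>"
    unfolding H2_class_def
    using Z.coset_join1 [OF _ _ subgroup_B2] Z.coset_join2 [OF _ subgroup_B2]
      subgroup.subset [OF subgroup_B2] by blast
  with assms show ?thesis by (simp add: H2_ML_def mem_B2)
qed

end

section \<open>Coordinates on a center extension\<close>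

text \<open>
  The cocycle of the extension lives on \<open>H\<close> and \<open>K\<close> and depends on the choice of \<open>t\<close>, so \<open>t\<close> is
  fixed together with the extension.
\<close>

locale center_extension_transversal =
  center_extension H G K i \<beta>
  for H :: "('h, 'l) mla_scheme" and G :: "('g, 'm) mla_scheme" and K :: "('k, 'n) mla_scheme"
    and i :: "'h \<Rightarrow> 'g" and \<beta> :: "'g \<Rightarrow> 'k" +
  fixes t :: "'k \<Rightarrow> 'g"
  assumes transversal: "transversal G K \<beta> t"
begin

abbreviation f :: "'k \<times> 'k \<Rightarrow> 'h" where "f \<equiv> ext_f H G K i t"
abbreviation h :: "'k \<times> 'k \<Rightarrow> 'h" where "h \<equiv> ext_h H G K i t"
abbreviation \<Gamma> :: "'k \<Rightarrow> 'h \<Rightarrow> 'h" where "\<Gamma> \<equiv> ext_Gamma H G K i t"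

lemma i_closed [simp]: "a \<in> carrier H \<Longrightarrow> i a \<in> carrier G"
  using i_hom by (auto simp: mla_hom_def hom_def)

lemma i_mult: "\<lbrakk>a \<in> carrier H; b \<in> carrier H\<rbrakk> \<Longrightarrow> i (a \<otimes>\<^bsub>H\<^esub> b) = i a \<otimes>\<^bsub>G\<^esub> i b"
  using i_hom by (auto simp: mla_hom_def hom_def)

lemma i_star: "\<lbrakk>a \<in> carrier H; b \<in> carrier H\<rbrakk> \<Longrightarrow> i (a \<star>\<^bsub>H\<^esub> b) = \<one>\<^bsub>G\<^esub>"
  using i_hom star_trivial by (auto simp: mla_hom_def)

lemma i_eq_iff [simp]: "\<lbrakk>a \<in> carrier H; b \<in> carrier H\<rbrakk> \<Longrightarrow> i a = i b \<longleftrightarrow> a = b"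
  using i_inj by (auto simp: inj_on_def)

lemma i_one [simp]: "i \<one>\<^bsub>H\<^esub> = \<one>\<^bsub>G\<^esub>"
  using i_mult [of "\<one>\<^bsub>H\<^esub>" "\<one>\<^bsub>H\<^esub>"] by simp

lemma i_inv: "a \<in> carrier H \<Longrightarrow> i (inv\<^bsub>H\<^esub> a) = inv\<^bsub>G\<^esub> (i a)"
  using i_mult [of "inv\<^bsub>H\<^esub> a" a] by (simp add: G.inv_equality)

text \<open>
  The operation \<open>\<star>\<close> of \<open>H\<close> is trivial, so the automorphisms of \<open>H\<close> are those of an abelian group.
\<close>

lemma star_H: "\<lbrakk>a \<in> carrier H; b \<in> carrier H\<rbrakk> \<Longrightarrow> a \<star>\<^bsub>H\<^esub> b = \<one>\<^bsub>H\<^esub>"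
  using i_star [of a b] i_eq_iff [of "a \<star>\<^bsub>H\<^esub> b" "\<one>\<^bsub>H\<^esub>"] by simp

lemma \<beta>_closed [simp]: "g \<in> carrier G \<Longrightarrow> \<beta> g \<in> carrier K"
  using \<beta>_hom by (auto simp: mla_hom_def hom_def)

lemma \<beta>_mult: "\<lbrakk>g \<in> carrier G; g' \<in> carrier G\<rbrakk> \<Longrightarrow> \<beta> (g \<otimes>\<^bsub>G\<^esub> g') = \<beta> g \<otimes>\<^bsub>K\<^esub> \<beta> g'"
  using \<beta>_hom by (auto simp: mla_hom_def hom_def)

lemma \<beta>_star: "\<lbrakk>g \<in> carrier G; g' \<in> carrier G\<rbrakk> \<Longrightarrow> \<beta> (g \<star>\<^bsub>G\<^esub> g') = \<beta> g \<star>\<^bsub>K\<^esub> \<beta> g'"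
  using \<beta>_hom by (auto simp: mla_hom_def)

lemma \<beta>_one [simp]: "\<beta> \<one>\<^bsub>G\<^esub> = \<one>\<^bsub>K\<^esub>"
  using \<beta>_mult [of "\<one>\<^bsub>G\<^esub>" "\<one>\<^bsub>G\<^esub>"] by simp

lemma \<beta>_inv: "g \<in> carrier G \<Longrightarrow> \<beta> (inv\<^bsub>G\<^esub> g) = inv\<^bsub>K\<^esub> (\<beta> g)"
  using \<beta>_mult [of "inv\<^bsub>G\<^esub> g" g] by (simp add: K.inv_equality)

lemma image_i_iff: "g \<in> i ` carrier H \<longleftrightarrow> g \<in> carrier G \<and> \<beta> g = \<one>\<^bsub>K\<^esub>"
  using exact by (auto simp: kernel_def)

lemma \<beta>_i [simp]: "a \<in> carrier H \<Longrightarrow> \<beta> (i a) = \<one>\<^bsub>K\<^esub>"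
  using image_i_iff by blast

lemma i_inv_into: "\<lbrakk>g \<in> carrier G; \<beta> g = \<one>\<^bsub>K\<^esub>\<rbrakk> \<Longrightarrow> i (inv_into (carrier H) i g) = g"
  using image_i_iff by (simp add: f_inv_into_f)

lemma inv_into_closed: "\<lbrakk>g \<in> carrier G; \<beta> g = \<one>\<^bsub>K\<^esub>\<rbrakk> \<Longrightarrow> inv_into (carrier H) i g \<in> carrier H"
  using image_i_iff by (simp add: inv_into_into)

lemma inv_into_i: "a \<in> carrier H \<Longrightarrow> inv_into (carrier H) i (i a) = a"
  using i_inj by simp

lemma i_central: "\<lbrakk>a \<in> carrier H; g \<in> carrier G\<rbrakk> \<Longrightarrow> g \<otimes>\<^bsub>G\<^esub> i a = i a \<otimes>\<^bsub>G\<^esub> g"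
  using central by (auto simp: group_center_def)

sublocale H: comm_group H
proof (rule H.group_comm_groupI)
  fix a b assume "a \<in> carrier H" "b \<in> carrier H"
  then have "i (a \<otimes>\<^bsub>H\<^esub> b) = i (b \<otimes>\<^bsub>H\<^esub> a)"
    by (simp add: i_mult i_central [of b "i a"])
  then show "a \<otimes>\<^bsub>H\<^esub> b = b \<otimes>\<^bsub>H\<^esub> a"
    using \<open>a \<in> carrier H\<close> \<open>b \<in> carrier H\<close> by simp
qed

lemma t_closed [simp]: "x \<in> carrier K \<Longrightarrow> t x \<in> carrier G"
  using transversal by (auto simp: transversal_def)

lemma \<beta>_t [simp]: "x \<in> carrier K \<Longrightarrow> \<beta> (t x) = x"
  using transversal by (auto simp: transversal_def)

lemma t_one [simp]: "t \<one>\<^bsub>K\<^esub> = \<one>\<^bsub>G\<^esub>"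
  using transversal by (auto simp: transversal_def)

lemma f_eqI:
  assumes "a \<in> carrier H" "x \<in> carrier K" "y \<in> carrier K"
    and "i a \<otimes>\<^bsub>G\<^esub> t (x \<otimes>\<^bsub>K\<^esub> y) = t x \<otimes>\<^bsub>G\<^esub> t y"
  shows "f (x, y) = a"
proof -
  have "t x \<otimes>\<^bsub>G\<^esub> t y \<otimes>\<^bsub>G\<^esub> inv\<^bsub>G\<^esub> (t (x \<otimes>\<^bsub>K\<^esub> y)) = i a"
    using assms by (metis G.inv_solve_right' G.m_closed K.m_closed i_closed t_closed)
  with assms show ?thesis by (simp add: ext_f_def inv_into_i)
qed

lemma h_eqI:
  assumes "a \<in> carrier H" "x \<in> carrier K" "y \<in> carrier K"
    and "i a \<otimes>\<^bsub>G\<^esub> t (x \<star>\<^bsub>K\<^esub> y) = t x \<star>\<^bsub>G\<^esub> t y"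
  shows "h (x, y) = a"
proof -
  have "(t x \<star>\<^bsub>G\<^esub> t y) \<otimes>\<^bsub>G\<^esub> inv\<^bsub>G\<^esub> (t (x \<star>\<^bsub>K\<^esub> y)) = i a"
    using assms by (metis G.inv_solve_right' G.star_closed K.star_closed i_closed t_closed)
  with assms show ?thesis by (simp add: ext_h_def inv_into_i)
qed

lemma \<Gamma>_eqI:
  assumes "b \<in> carrier H" "x \<in> carrier K" "a \<in> carrier H" "i b = t x \<star>\<^bsub>G\<^esub> i a"
  shows "\<Gamma> x a = b"
  using assms by (simp add: ext_Gamma_def inv_into_i flip: assms(4))

lemma
  assumes [simp]: "x \<in> carrier K" "y \<in> carrier K"
  shows f_closed [simp]: "f (x, y) \<in> carrier H"
    and t_mult: "t x \<otimes>\<^bsub>G\<^esub> t y = i (f (x, y)) \<otimes>\<^bsub>G\<^esub> t (x \<otimes>\<^bsub>K\<^esub> y)"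
    and h_closed [simp]: "h (x, y) \<in> carrier H"
    and t_star: "t x \<star>\<^bsub>G\<^esub> t y = i (h (x, y)) \<otimes>\<^bsub>G\<^esub> t (x \<star>\<^bsub>K\<^esub> y)"
proof -
  let ?g = "t x \<otimes>\<^bsub>G\<^esub> t y \<otimes>\<^bsub>G\<^esub> inv\<^bsub>G\<^esub> (t (x \<otimes>\<^bsub>K\<^esub> y))"
  have "?g \<in> carrier G" "\<beta> ?g = \<one>\<^bsub>K\<^esub>"
    by (simp_all add: \<beta>_mult \<beta>_inv)
  then show "f (x, y) \<in> carrier H" "t x \<otimes>\<^bsub>G\<^esub> t y = i (f (x, y)) \<otimes>\<^bsub>G\<^esub> t (x \<otimes>\<^bsub>K\<^esub> y)"
    by (simp_all add: ext_f_def inv_into_closed i_inv_into G.m_assoc)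
  let ?g = "(t x \<star>\<^bsub>G\<^esub> t y) \<otimes>\<^bsub>G\<^esub> inv\<^bsub>G\<^esub> (t (x \<star>\<^bsub>K\<^esub> y))"
  have "?g \<in> carrier G" "\<beta> ?g = \<one>\<^bsub>K\<^esub>"
    by (simp_all add: \<beta>_mult \<beta>_inv \<beta>_star)
  then show "h (x, y) \<in> carrier H" "t x \<star>\<^bsub>G\<^esub> t y = i (h (x, y)) \<otimes>\<^bsub>G\<^esub> t (x \<star>\<^bsub>K\<^esub> y)"
    by (simp_all add: ext_h_def inv_into_closed i_inv_into G.m_assoc)
qed

lemma
  assumes [simp]: "x \<in> carrier K" "a \<in> carrier H"
  shows \<Gamma>_carrier: "\<Gamma> x a \<in> carrier H"
    and star_i: "t x \<star>\<^bsub>G\<^esub> i a = i (\<Gamma> x a)"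
proof -
  have "t x \<star>\<^bsub>G\<^esub> i a \<in> carrier G" "\<beta> (t x \<star>\<^bsub>G\<^esub> i a) = \<one>\<^bsub>K\<^esub>"
    by (simp_all add: \<beta>_star)
  then show "\<Gamma> x a \<in> carrier H" "t x \<star>\<^bsub>G\<^esub> i a = i (\<Gamma> x a)"
    by (simp_all add: ext_Gamma_def inv_into_closed i_inv_into)
qed

lemma conj_central:
  "\<lbrakk>a \<in> carrier H; g \<in> carrier G\<rbrakk> \<Longrightarrow> conj_by G (i a) g = g"
  "\<lbrakk>a \<in> carrier H; g \<in> carrier G\<rbrakk> \<Longrightarrow> conj_by G g (i a) = i a"
  by (simp_all add: G.conj_by_eq_iff i_central)

sublocale cochains K H \<Gamma>
proof
  fix x assume x: "x \<in> carrier K"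
  have "\<Gamma> x (a \<otimes>\<^bsub>H\<^esub> b) = \<Gamma> x a \<otimes>\<^bsub>H\<^esub> \<Gamma> x b" if "a \<in> carrier H" "b \<in> carrier H" for a b
    using x that
    by (intro \<Gamma>_eqI) (simp_all add: \<Gamma>_carrier i_mult G.star_mult_right conj_central star_i)
  with x show "\<Gamma> x \<in> hom H H" by (simp add: hom_def \<Gamma>_carrier)
qed

text \<open>
  Every element of \<open>G\<close> has this form for exactly one pair \<open>(a, x)\<close>; the pair serves as its
  coordinates.
\<close>

definition elt :: "'h \<Rightarrow> 'k \<Rightarrow> 'g"
  where "elt a x = i a \<otimes>\<^bsub>G\<^esub> t x"

lemma elt_closed [simp]: "\<lbrakk>a \<in> carrier H; x \<in> carrier K\<rbrakk> \<Longrightarrow> elt a x \<in> carrier G"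
  by (simp add: elt_def)

lemma \<beta>_elt [simp]: "\<lbrakk>a \<in> carrier H; x \<in> carrier K\<rbrakk> \<Longrightarrow> \<beta> (elt a x) = x"
  by (simp add: elt_def \<beta>_mult)

lemma elt_eq_iff:
  assumes "a \<in> carrier H" "x \<in> carrier K" "b \<in> carrier H" "y \<in> carrier K"
  shows "elt a x = elt b y \<longleftrightarrow> a = b \<and> x = y"
proof
  assume eq: "elt a x = elt b y"
  then have "x = y" using assms by (metis \<beta>_elt)
  with eq assms show "a = b \<and> x = y" by (simp add: elt_def)
qed simp

lemma elt_exhaust:
  assumes "g \<in> carrier G"
  obtains a x where "a \<in> carrier H" "x \<in> carrier K" "g = elt a x"
proof -
  let ?g = "g \<otimes>\<^bsub>G\<^esub> inv\<^bsub>G\<^esub> (t (\<beta> g))"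
  have "?g \<in> carrier G" "\<beta> ?g = \<one>\<^bsub>K\<^esub>" using assms by (simp_all add: \<beta>_mult \<beta>_inv)
  then obtain a where "a \<in> carrier H" and a: "?g = i a" using image_i_iff by blast
  have "g = elt a (\<beta> g)"
    using assms by (simp add: elt_def G.m_assoc flip: a)
  then show ?thesis by (rule that [OF \<open>a \<in> carrier H\<close> \<beta>_closed [OF assms]])
qed

lemma elt_one: "elt \<one>\<^bsub>H\<^esub> \<one>\<^bsub>K\<^esub> = \<one>\<^bsub>G\<^esub>"
  by (simp add: elt_def)

lemma i_eq_elt: "a \<in> carrier H \<Longrightarrow> i a = elt a \<one>\<^bsub>K\<^esub>"
  by (simp add: elt_def)

lemma t_eq_elt: "x \<in> carrier K \<Longrightarrow> t x = elt \<one>\<^bsub>H\<^esub> x"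
  by (simp add: elt_def)

lemma elt_mult:
  assumes [simp]: "a \<in> carrier H" "x \<in> carrier K" "b \<in> carrier H" "y \<in> carrier K"
  shows "elt a x \<otimes>\<^bsub>G\<^esub> elt b y = elt (a \<otimes>\<^bsub>H\<^esub> b \<otimes>\<^bsub>H\<^esub> f (x, y)) (x \<otimes>\<^bsub>K\<^esub> y)"
proof -
  have "elt a x \<otimes>\<^bsub>G\<^esub> elt b y = i a \<otimes>\<^bsub>G\<^esub> (t x \<otimes>\<^bsub>G\<^esub> i b) \<otimes>\<^bsub>G\<^esub> t y"
    by (simp add: elt_def G.m_assoc)
  also have "\<dots> = i a \<otimes>\<^bsub>G\<^esub> i b \<otimes>\<^bsub>G\<^esub> (t x \<otimes>\<^bsub>G\<^esub> t y)"
    by (simp add: i_central [of b "t x"] G.m_assoc)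
  also have "\<dots> = elt (a \<otimes>\<^bsub>H\<^esub> b \<otimes>\<^bsub>H\<^esub> f (x, y)) (x \<otimes>\<^bsub>K\<^esub> y)"
    by (simp add: t_mult elt_def i_mult G.m_assoc)
  finally show ?thesis .
qed

lemma elt_star:
  assumes [simp]: "a \<in> carrier H" "x \<in> carrier K" "b \<in> carrier H" "y \<in> carrier K"
  shows "elt a x \<star>\<^bsub>G\<^esub> elt b y
    = elt (\<Gamma> x b \<otimes>\<^bsub>H\<^esub> \<Gamma> y (inv\<^bsub>H\<^esub> a) \<otimes>\<^bsub>H\<^esub> h (x, y)) (x \<star>\<^bsub>K\<^esub> y)"
proof -
  have right: "g \<star>\<^bsub>G\<^esub> elt b y = (g \<star>\<^bsub>G\<^esub> i b) \<otimes>\<^bsub>G\<^esub> (g \<star>\<^bsub>G\<^esub> t y)" if "g \<in> carrier G" for g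
    using that by (simp add: elt_def G.star_mult_right conj_central)
  have "elt a x \<star>\<^bsub>G\<^esub> elt b y = (t x \<star>\<^bsub>G\<^esub> elt b y) \<otimes>\<^bsub>G\<^esub> (i a \<star>\<^bsub>G\<^esub> elt b y)"
    by (simp add: elt_def [of a] G.star_mult_left conj_central)
  also have "i a \<star>\<^bsub>G\<^esub> elt b y = i (\<Gamma> y (inv\<^bsub>H\<^esub> a))"
    by (simp add: right star_trivial G.star_anticomm [of "t y"] star_i \<Gamma>_inv i_inv)
  also have "(t x \<star>\<^bsub>G\<^esub> elt b y) \<otimes>\<^bsub>G\<^esub> i (\<Gamma> y (inv\<^bsub>H\<^esub> a))
    = elt (\<Gamma> x b \<otimes>\<^bsub>H\<^esub> \<Gamma> y (inv\<^bsub>H\<^esub> a) \<otimes>\<^bsub>H\<^esub> h (x, y)) (x \<star>\<^bsub>K\<^esub> y)"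
    unfolding right [OF t_closed [OF \<open>x \<in> carrier K\<close>]]
    by (simp add: star_i t_star elt_def i_mult G.m_assoc i_central [of _ "t _"])
      (simp flip: G.m_assoc i_mult add: H.m_ac)
  finally show ?thesis .
qed

lemma f_one_left: "x \<in> carrier K \<Longrightarrow> f (\<one>\<^bsub>K\<^esub>, x) = \<one>\<^bsub>H\<^esub>"
  by (rule f_eqI) simp_all

lemma f_one_right: "x \<in> carrier K \<Longrightarrow> f (x, \<one>\<^bsub>K\<^esub>) = \<one>\<^bsub>H\<^esub>"
  by (rule f_eqI) simp_all

lemma h_one_right: "x \<in> carrier K \<Longrightarrow> h (x, \<one>\<^bsub>K\<^esub>) = \<one>\<^bsub>H\<^esub>"
  by (rule h_eqI) simp_all

lemma f_assoc:
  assumes [simp]: "x \<in> carrier K" "y \<in> carrier K" "z \<in> carrier K"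
  shows "f (x, y) \<otimes>\<^bsub>H\<^esub> f (x \<otimes>\<^bsub>K\<^esub> y, z) = f (y, z) \<otimes>\<^bsub>H\<^esub> f (x, y \<otimes>\<^bsub>K\<^esub> z)"
proof -
  have "(elt \<one>\<^bsub>H\<^esub> x \<otimes>\<^bsub>G\<^esub> elt \<one>\<^bsub>H\<^esub> y) \<otimes>\<^bsub>G\<^esub> elt \<one>\<^bsub>H\<^esub> z = elt \<one>\<^bsub>H\<^esub> x \<otimes>\<^bsub>G\<^esub> (elt \<one>\<^bsub>H\<^esub> y \<otimes>\<^bsub>G\<^esub> elt \<one>\<^bsub>H\<^esub> z)"
    by (simp add: G.m_assoc)
  then show ?thesis by (simp add: elt_mult elt_eq_iff)
qed

abbreviation c :: "'k \<Rightarrow> 'k \<Rightarrow> 'h" where "c \<equiv> cocycle_c K H f"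

lemma c_closed [simp]: "\<lbrakk>z \<in> carrier K; w \<in> carrier K\<rbrakk> \<Longrightarrow> c z w \<in> carrier H"
  by (simp add: cocycle_c_def)

text \<open>
  Two instances of the cocycle identity, at \<open>(z w, z\<^sup>-\<^sup>1, z)\<close> and at \<open>(z\<^sup>-\<^sup>1, z, w)\<close>, share the value
  \<open>f(z\<^sup>-\<^sup>1, z)\<close>; eliminating it leaves this equation, by which
  \<open>c z w\<close> is the \<open>H\<close>-coordinate of the conjugate of \<open>t w\<close> by \<open>t z\<close>.
\<close>

lemma c_mult_f:
  assumes [simp]: "z \<in> carrier K" "w \<in> carrier K"
  shows "c z w \<otimes>\<^bsub>H\<^esub> f (conj_by K z w, z) = f (z, w)"
proof -
  let ?z = "inv\<^bsub>K\<^esub> z" and ?zw = "z \<otimes>\<^bsub>K\<^esub> w"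
  have "f (?zw, ?z) \<otimes>\<^bsub>H\<^esub> f (conj_by K z w, z) = f (?z, z)"
    using f_assoc [of ?zw ?z z] by (simp add: conj_by_def f_one_right)
  moreover have "f (?z, z) = f (z, w) \<otimes>\<^bsub>H\<^esub> f (?z, ?zw)"
    using f_assoc [of ?z z w] by (simp add: f_one_left)
  ultimately show ?thesis
    by (simp add: cocycle_c_def H.m_assoc) (simp add: H.m_comm H.inv_solve_left')
qed

lemma elt_conj:
  assumes [simp]: "x \<in> carrier K" "b \<in> carrier H" "y \<in> carrier K" "a \<in> carrier H"
  shows "conj_by G (elt a x) (elt b y) = elt (b \<otimes>\<^bsub>H\<^esub> c x y) (conj_by K x y)"
proof -
  have "elt (b \<otimes>\<^bsub>H\<^esub> c x y) (conj_by K x y) \<otimes>\<^bsub>G\<^esub> elt a x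
    = elt (a \<otimes>\<^bsub>H\<^esub> b \<otimes>\<^bsub>H\<^esub> (c x y \<otimes>\<^bsub>H\<^esub> f (conj_by K x y, x))) (conj_by K x y \<otimes>\<^bsub>K\<^esub> x)"
    by (simp add: elt_mult H.m_ac)
  also have "\<dots> = elt a x \<otimes>\<^bsub>G\<^esub> elt b y"
    by (simp add: elt_mult c_mult_f) (simp add: conj_by_def K.m_assoc)
  finally show ?thesis by (simp add: G.conj_by_eq_iff)
qed

lemma \<Gamma>_one_left [simp]: "a \<in> carrier H \<Longrightarrow> \<Gamma> \<one>\<^bsub>K\<^esub> a = \<one>\<^bsub>H\<^esub>"
  by (rule \<Gamma>_eqI) simp_all

lemma \<Gamma>_mult_left:
  assumes [simp]: "x \<in> carrier K" "y \<in> carrier K" "a \<in> carrier H"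
  shows "\<Gamma> (x \<otimes>\<^bsub>K\<^esub> y) a = \<Gamma> x a \<otimes>\<^bsub>H\<^esub> \<Gamma> y a"
proof -
  have "(elt \<one>\<^bsub>H\<^esub> x \<otimes>\<^bsub>G\<^esub> elt \<one>\<^bsub>H\<^esub> y) \<star>\<^bsub>G\<^esub> i a = i (\<Gamma> x a \<otimes>\<^bsub>H\<^esub> \<Gamma> y a)"
    by (simp add: G.star_mult_left conj_central star_i i_mult i_central [of "\<Gamma> x a" "i (\<Gamma> y a)"]
        flip: t_eq_elt)
  then show ?thesis
    by (simp add: i_eq_elt elt_mult elt_star elt_eq_iff h_one_right)
qed

text \<open>
  The map \<open>x \<mapsto> \<Gamma> x\<close> is a homomorphism into an abelian group, hence constant on conjugacy classes.
  This is why the cocycle identities contain \<open>\<Gamma> x\<close> where the axioms of \<open>G\<close> produce \<open>\<Gamma>\<close> of a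
  conjugate of \<open>x\<close>.
\<close>

lemma \<Gamma>_conj:
  assumes [simp]: "z \<in> carrier K" "x \<in> carrier K" "a \<in> carrier H"
  shows "\<Gamma> (conj_by K z x) a = \<Gamma> x a"
proof -
  have "\<Gamma> (conj_by K z x) a \<otimes>\<^bsub>H\<^esub> \<Gamma> z a = \<Gamma> (conj_by K z x \<otimes>\<^bsub>K\<^esub> z) a"
    by (simp add: \<Gamma>_mult_left)
  also have "conj_by K z x \<otimes>\<^bsub>K\<^esub> z = z \<otimes>\<^bsub>K\<^esub> x"
    by (simp add: conj_by_def K.m_assoc)
  also have "\<Gamma> (z \<otimes>\<^bsub>K\<^esub> x) a = \<Gamma> x a \<otimes>\<^bsub>H\<^esub> \<Gamma> z a"
    by (simp add: \<Gamma>_mult_left H.m_comm)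
  finally show ?thesis by simp
qed

text \<open>
  The last five identities are associativity, the two expansion laws of \<open>\<star>\<close>, its compatibility with
  conjugation, and the Jacobi identity of \<open>G\<close>.
\<close>

lemma center_cocycle_ext: "center_cocycle K H \<Gamma> f h"
  unfolding center_cocycle_def
proof (intro conjI ballI)
  have "f \<in> extensional (carrier K \<times> carrier K)" "h \<in> extensional (carrier K \<times> carrier K)"
    by (simp_all add: ext_f_def ext_h_def)
  then show "f \<in> carrier K \<times> carrier K \<rightarrow>\<^sub>E carrier H" "h \<in> carrier K \<times> carrier K \<rightarrow>\<^sub>E carrier H"
    by (simp_all add: PiE_iff)
  fix x assume x [simp]: "x \<in> carrier K"
  show "f (\<one>\<^bsub>K\<^esub>, x) = \<one>\<^bsub>H\<^esub>" "f (x, \<one>\<^bsub>K\<^esub>) = \<one>\<^bsub>H\<^esub>"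
    by (simp_all add: f_one_left f_one_right)
  show "h (x, x) = \<one>\<^bsub>H\<^esub>" "h (x, \<one>\<^bsub>K\<^esub>) = \<one>\<^bsub>H\<^esub>" "h (\<one>\<^bsub>K\<^esub>, x) = \<one>\<^bsub>H\<^esub>"
    by (simp_all add: h_eqI G.star_self K.star_self)
  fix y z assume y [simp]: "y \<in> carrier K" and z [simp]: "z \<in> carrier K"
  let ?X = "elt \<one>\<^bsub>H\<^esub> x" and ?Y = "elt \<one>\<^bsub>H\<^esub> y" and ?Z = "elt \<one>\<^bsub>H\<^esub> z"
  show "f (x, y) \<otimes>\<^bsub>H\<^esub> f (x \<otimes>\<^bsub>K\<^esub> y, z) = f (y, z) \<otimes>\<^bsub>H\<^esub> f (x, y \<otimes>\<^bsub>K\<^esub> z)"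
    by (rule f_assoc) simp_all
  have "(?X \<star>\<^bsub>G\<^esub> ?Y) \<otimes>\<^bsub>G\<^esub> conj_by G ?Y (?X \<star>\<^bsub>G\<^esub> ?Z) = ?X \<star>\<^bsub>G\<^esub> (?Y \<otimes>\<^bsub>G\<^esub> ?Z)"
    by (simp add: G.star_mult_right)
  then show "c y (x \<star>\<^bsub>K\<^esub> z) \<otimes>\<^bsub>H\<^esub> f (x \<star>\<^bsub>K\<^esub> y, conj_by K y (x \<star>\<^bsub>K\<^esub> z)) \<otimes>\<^bsub>H\<^esub> h (x, y) \<otimes>\<^bsub>H\<^esub> h (x, z)
    = \<Gamma> x (f (y, z)) \<otimes>\<^bsub>H\<^esub> h (x, y \<otimes>\<^bsub>K\<^esub> z)"
    by (simp add: elt_mult elt_star elt_conj elt_eq_iff H.m_ac)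
  have "conj_by G ?X (?Y \<star>\<^bsub>G\<^esub> ?Z) \<otimes>\<^bsub>G\<^esub> (?X \<star>\<^bsub>G\<^esub> ?Z) = (?X \<otimes>\<^bsub>G\<^esub> ?Y) \<star>\<^bsub>G\<^esub> ?Z"
    by (simp add: G.star_mult_left)
  then show "c x (y \<star>\<^bsub>K\<^esub> z) \<otimes>\<^bsub>H\<^esub> f (conj_by K x (y \<star>\<^bsub>K\<^esub> z), x \<star>\<^bsub>K\<^esub> z) \<otimes>\<^bsub>H\<^esub> h (x, z) \<otimes>\<^bsub>H\<^esub> h (y, z)
    = \<Gamma> z (inv\<^bsub>H\<^esub> (f (x, y))) \<otimes>\<^bsub>H\<^esub> h (x \<otimes>\<^bsub>K\<^esub> y, z)"
    by (simp add: elt_mult elt_star elt_conj elt_eq_iff H.m_ac)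
  have "conj_by G ?Z ?X \<star>\<^bsub>G\<^esub> conj_by G ?Z ?Y = conj_by G ?Z (?X \<star>\<^bsub>G\<^esub> ?Y)"
    by (simp add: G.star_conj)
  then show "\<Gamma> x (c z y) \<otimes>\<^bsub>H\<^esub> \<Gamma> y (inv\<^bsub>H\<^esub> (c z x)) \<otimes>\<^bsub>H\<^esub> h (conj_by K z x, conj_by K z y)
    = c z (x \<star>\<^bsub>K\<^esub> y) \<otimes>\<^bsub>H\<^esub> h (x, y)"
    by (simp add: elt_mult elt_star elt_conj elt_eq_iff \<Gamma>_conj H.m_ac)
  let ?A = "(x \<star>\<^bsub>K\<^esub> y) \<star>\<^bsub>K\<^esub> conj_by K y z" and ?B = "(y \<star>\<^bsub>K\<^esub> z) \<star>\<^bsub>K\<^esub> conj_by K z x"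
    and ?C = "(z \<star>\<^bsub>K\<^esub> x) \<star>\<^bsub>K\<^esub> conj_by K x y"
  \<comment> \<open>The Jacobi identity of \<open>K\<close> puts the last value of \<open>f\<close> into the form \<open>f (inv C, C)\<close>.\<close>
  have "?A \<otimes>\<^bsub>K\<^esub> ?B = inv\<^bsub>K\<^esub> ?C"
    using K.star_jacobi [of x y z] by (intro K.inv_equality [symmetric]) auto
  moreover have "((?X \<star>\<^bsub>G\<^esub> ?Y) \<star>\<^bsub>G\<^esub> conj_by G ?Y ?Z) \<otimes>\<^bsub>G\<^esub> ((?Y \<star>\<^bsub>G\<^esub> ?Z) \<star>\<^bsub>G\<^esub> conj_by G ?Z ?X)
      \<otimes>\<^bsub>G\<^esub> ((?Z \<star>\<^bsub>G\<^esub> ?X) \<star>\<^bsub>G\<^esub> conj_by G ?X ?Y) = elt \<one>\<^bsub>H\<^esub> \<one>\<^bsub>K\<^esub>"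
    by (simp add: G.star_jacobi elt_one)
  ultimately show "\<Gamma> (x \<star>\<^bsub>K\<^esub> y) (c y z) \<otimes>\<^bsub>H\<^esub> \<Gamma> (y \<star>\<^bsub>K\<^esub> z) (c z x) \<otimes>\<^bsub>H\<^esub> \<Gamma> (z \<star>\<^bsub>K\<^esub> x) (c x y)
      \<otimes>\<^bsub>H\<^esub> \<Gamma> z (inv\<^bsub>H\<^esub> (h (x, y))) \<otimes>\<^bsub>H\<^esub> \<Gamma> x (inv\<^bsub>H\<^esub> (h (y, z))) \<otimes>\<^bsub>H\<^esub> \<Gamma> y (inv\<^bsub>H\<^esub> (h (z, x)))
      \<otimes>\<^bsub>H\<^esub> h (x \<star>\<^bsub>K\<^esub> y, conj_by K y z) \<otimes>\<^bsub>H\<^esub> h (y \<star>\<^bsub>K\<^esub> z, conj_by K z x)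
      \<otimes>\<^bsub>H\<^esub> h (z \<star>\<^bsub>K\<^esub> x, conj_by K x y) \<otimes>\<^bsub>H\<^esub> f (?A, ?B) \<otimes>\<^bsub>H\<^esub> f (inv\<^bsub>K\<^esub> ?C, ?C) = \<one>\<^bsub>H\<^esub>"
    by (simp add: elt_mult elt_star elt_conj elt_eq_iff \<Gamma>_conj H.m_ac)
qed

end

section \<open>Twisting the ends of the extension\<close>

lemma (in comm_group) ratio_eq_iff:
  assumes [simp]: "a \<in> carrier G" "b \<in> carrier G" "l \<in> carrier G" "m \<in> carrier G" "n \<in> carrier G"
  shows "a \<otimes> inv b = l \<otimes> m \<otimes> inv n \<longleftrightarrow> b \<otimes> inv n = inv l \<otimes> inv m \<otimes> a"
proof -
  have "a \<otimes> inv b = l \<otimes> m \<otimes> inv n \<longleftrightarrow> a = l \<otimes> m \<otimes> inv n \<otimes> b"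
    using inv_solve_right [of "l \<otimes> m \<otimes> inv n" a b] by auto
  also have "l \<otimes> m \<otimes> inv n \<otimes> b = (l \<otimes> m) \<otimes> (b \<otimes> inv n)"
    by (simp add: m_ac)
  also have "a = (l \<otimes> m) \<otimes> (b \<otimes> inv n) \<longleftrightarrow> b \<otimes> inv n = inv (l \<otimes> m) \<otimes> a"
    by (simp add: inv_solve_left)
  also have "inv (l \<otimes> m) = inv l \<otimes> inv m"
    by (simp add: inv_mult)
  finally show ?thesis .
qed

lemma mla_hom_compose:
  "\<lbrakk>\<phi> \<in> mla_hom L M; \<psi> \<in> mla_hom M N\<rbrakk> \<Longrightarrow> \<psi> \<circ> \<phi> \<in> mla_hom L N"
  by (auto simp: mla_hom_def hom_def Pi_iff)

lemma mla_auto_hom: "\<phi> \<in> mla_auto L \<Longrightarrow> \<phi> \<in> mla_hom L L"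
  by (simp add: mla_auto_def)

lemma mla_auto_image: "\<phi> \<in> mla_auto L \<Longrightarrow> \<phi> ` carrier L = carrier L"
  by (simp add: mla_auto_iff bij_betw_def)

context center_extension_transversal
begin

abbreviation id_H :: "'h \<Rightarrow> 'h" where "id_H \<equiv> (\<lambda>a\<in>carrier H. a)"
abbreviation id_K :: "'k \<Rightarrow> 'k" where "id_K \<equiv> (\<lambda>x\<in>carrier K. x)"

lemma C1_iff:
  "\<alpha> \<in> carrier (C1_L H K \<Gamma>) \<longleftrightarrow>
    \<alpha> \<in> mla_auto H \<and> (\<forall>x\<in>carrier K. \<forall>a\<in>carrier H. \<alpha> (\<Gamma> x a) = \<Gamma> x (\<alpha> a))"
  by (simp add: C1_L_def)

lemma C2_iff:
  "\<eta> \<in> carrier (C2_L H K \<Gamma>) \<longleftrightarrow>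
    \<eta> \<in> mla_auto K \<and> (\<forall>x\<in>carrier K. \<forall>a\<in>carrier H. \<Gamma> (\<eta> x) a = \<Gamma> x a)"
  by (simp add: C2_L_def)

lemma id_C1: "id_H \<in> carrier (C1_L H K \<Gamma>)"
  by (simp add: C1_iff H.mla_auto_id)

lemma id_C2: "id_K \<in> carrier (C2_L H K \<Gamma>)"
  by (simp add: C2_iff K.mla_auto_id)

lemma group_C1: "group (C1_L H K \<Gamma>)"
  unfolding C1_L_def
proof (rule H.group_Aut_on)
  fix \<alpha> \<alpha>' assume "\<alpha> \<in> mla_auto H" "\<alpha>' \<in> mla_auto H"
    and "\<forall>x\<in>carrier K. \<forall>a\<in>carrier H. \<alpha> (\<Gamma> x a) = \<Gamma> x (\<alpha> a)"
    and "\<forall>a\<in>carrier H. \<alpha> (\<alpha>' a) = a \<and> \<alpha>' (\<alpha> a) = a"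
  then show "\<forall>x\<in>carrier K. \<forall>a\<in>carrier H. \<alpha>' (\<Gamma> x a) = \<Gamma> x (\<alpha>' a)"
    by (metis \<Gamma>_closed mla_auto_closed)
qed (auto simp: compose_eq mla_auto_closed)

lemma group_C2: "group (C2_L H K \<Gamma>)"
  unfolding C2_L_def
proof (rule K.group_Aut_on)
  fix \<eta> \<eta>' assume "\<eta> \<in> mla_auto K" "\<eta>' \<in> mla_auto K"
    and "\<forall>x\<in>carrier K. \<forall>a\<in>carrier H. \<Gamma> (\<eta> x) a = \<Gamma> x a"
    and "\<forall>x\<in>carrier K. \<eta> (\<eta>' x) = x \<and> \<eta>' (\<eta> x) = x"
  then show "\<forall>x\<in>carrier K. \<forall>a\<in>carrier H. \<Gamma> (\<eta>' x) a = \<Gamma> x a"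
    by (metis mla_auto_closed)
qed (auto simp: compose_eq mla_auto_closed)

text \<open>
  With \<open>i \<circ> \<alpha>\<^sup>-\<^sup>1\<close>, \<open>\<eta>\<^sup>-\<^sup>1 \<circ> \<beta>\<close> and \<open>t \<circ> \<eta>\<close> in place of \<open>i\<close>, \<open>\<beta>\<close> and \<open>t\<close>, the algebra \<open>G\<close> is again a
  center extension of \<open>K\<close> by \<open>H\<close>. Its action is \<open>x \<mapsto> \<alpha> \<circ> \<Gamma> (\<eta> x) \<circ> \<alpha>\<^sup>-\<^sup>1\<close>, which is \<open>\<Gamma>\<close> because
  \<open>\<alpha> \<in> C\<^sub>1\<close> and \<open>\<eta> \<in> C\<^sub>2\<close>, and its cocycle is the one below; so the cocycle identities are inherited
  from \<open>center_cocycle_ext\<close>.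
\<close>

lemma center_cocycle_twisted:
  assumes \<alpha>: "\<alpha> \<in> carrier (C1_L H K \<Gamma>)" and \<eta>: "\<eta> \<in> carrier (C2_L H K \<Gamma>)"
  shows "center_cocycle K H \<Gamma>
    (\<lambda>(x, y)\<in>carrier K \<times> carrier K. \<alpha> (f (\<eta> x, \<eta> y)))
    (\<lambda>(x, y)\<in>carrier K \<times> carrier K. \<alpha> (h (\<eta> x, \<eta> y)))"
proof -
  have \<alpha>_auto: "\<alpha> \<in> mla_auto H" and \<eta>_auto: "\<eta> \<in> mla_auto K"
    using \<alpha> \<eta> by (simp_all add: C1_iff C2_iff)
  note closed [simp] = mla_auto_closed [OF \<alpha>_auto] mla_auto_closed [OF \<eta>_auto]
  obtain \<alpha>' where \<alpha>'_auto: "\<alpha>' \<in> mla_auto H"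
    and [simp]: "\<And>a. a \<in> carrier H \<Longrightarrow> \<alpha> (\<alpha>' a) = a" "\<And>a. a \<in> carrier H \<Longrightarrow> \<alpha>' (\<alpha> a) = a"
    using H.mla_auto_inverse [OF \<alpha>_auto] by blast
  obtain \<eta>' where \<eta>'_auto: "\<eta>' \<in> mla_auto K"
    and [simp]: "\<And>x. x \<in> carrier K \<Longrightarrow> \<eta> (\<eta>' x) = x" "\<And>x. x \<in> carrier K \<Longrightarrow> \<eta>' (\<eta> x) = x"
    using K.mla_auto_inverse [OF \<eta>_auto] by blast
  note [simp] = mla_auto_closed [OF \<alpha>'_auto] mla_auto_closed [OF \<eta>'_auto]
  have image: "(i \<circ> \<alpha>') ` carrier H = i ` carrier H"
    using \<alpha>'_auto by (metis image_comp mla_auto_image)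
  have T: "center_extension_transversal H G K (i \<circ> \<alpha>') (\<eta>' \<circ> \<beta>) (t \<circ> \<eta>)"
  proof unfold_locales
    show "i \<circ> \<alpha>' \<in> mla_hom H G" "\<eta>' \<circ> \<beta> \<in> mla_hom G K"
      using i_hom \<beta>_hom \<alpha>'_auto \<eta>'_auto by (auto intro: mla_hom_compose mla_auto_hom)
    show "inj_on (i \<circ> \<alpha>') (carrier H)"
      using i_inj \<alpha>'_auto by (auto intro!: inj_onI simp: mla_auto_inj)
    show "(\<eta>' \<circ> \<beta>) ` carrier G = carrier K"
      using \<eta>'_auto by (metis \<beta>_surj image_comp mla_auto_image)
    have "\<eta>' x = \<one>\<^bsub>K\<^esub> \<longleftrightarrow> x = \<one>\<^bsub>K\<^esub>" if "x \<in> carrier K" for x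
      using mla_auto_inj [OF \<eta>'_auto that K.one_closed] \<eta>'_auto by simp
    then have "kernel G K (\<eta>' \<circ> \<beta>) = kernel G K \<beta>"
      by (auto simp: kernel_def)
    then show "(i \<circ> \<alpha>') ` carrier H = kernel G K (\<eta>' \<circ> \<beta>)"
      using exact image by simp
    show "(i \<circ> \<alpha>') ` carrier H \<subseteq> group_center G"
      using central image by simp
    show "(i \<circ> \<alpha>') a \<star>\<^bsub>G\<^esub> (i \<circ> \<alpha>') b = \<one>\<^bsub>G\<^esub>" if "a \<in> carrier H" "b \<in> carrier H" for a b
      using that by (simp add: star_trivial)
    show "transversal G K (\<eta>' \<circ> \<beta>) (t \<circ> \<eta>)"
      using \<eta>_auto by (simp add: transversal_def)
  qed
  have "ext_f H G K (i \<circ> \<alpha>') (t \<circ> \<eta>) = (\<lambda>(x, y)\<in>carrier K \<times> carrier K. \<alpha> (f (\<eta> x, \<eta> y)))"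
  proof (rule extensionalityI [of _ "carrier K \<times> carrier K"])
    fix p assume "p \<in> carrier K \<times> carrier K"
    then show "ext_f H G K (i \<circ> \<alpha>') (t \<circ> \<eta>) p = (\<lambda>(x, y)\<in>carrier K \<times> carrier K. \<alpha> (f (\<eta> x, \<eta> y))) p"
      by (auto intro!: center_extension_transversal.f_eqI [OF T]
          simp: t_mult mla_auto_mult [OF \<eta>_auto])
  qed (auto simp: ext_f_def)
  moreover have "ext_h H G K (i \<circ> \<alpha>') (t \<circ> \<eta>) = (\<lambda>(x, y)\<in>carrier K \<times> carrier K. \<alpha> (h (\<eta> x, \<eta> y)))"
  proof (rule extensionalityI [of _ "carrier K \<times> carrier K"])
    fix p assume "p \<in> carrier K \<times> carrier K"
    then show "ext_h H G K (i \<circ> \<alpha>') (t \<circ> \<eta>) p = (\<lambda>(x, y)\<in>carrier K \<times> carrier K. \<alpha> (h (\<eta> x, \<eta> y))) p"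
      by (auto intro!: center_extension_transversal.h_eqI [OF T]
          simp: t_star mla_auto_star [OF \<eta>_auto])
  qed (auto simp: ext_h_def)
  moreover have "ext_Gamma H G K (i \<circ> \<alpha>') (t \<circ> \<eta>) = \<Gamma>"
  proof (rule extensionalityI [of _ "carrier K"])
    fix x assume x: "x \<in> carrier K"
    show "ext_Gamma H G K (i \<circ> \<alpha>') (t \<circ> \<eta>) x = \<Gamma> x"
    proof (rule extensionalityI [of _ "carrier H"])
      fix a assume a: "a \<in> carrier H"
      have "\<Gamma> (\<eta> x) (\<alpha>' a) = \<alpha>' (\<alpha> (\<Gamma> x (\<alpha>' a)))"
        using x a \<eta> by (simp add: C2_iff)
      also have "\<dots> = \<alpha>' (\<Gamma> x a)"
        using x a \<alpha> by (simp add: C1_iff)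
      finally show "ext_Gamma H G K (i \<circ> \<alpha>') (t \<circ> \<eta>) x a = \<Gamma> x a"
        using x a by (intro center_extension_transversal.\<Gamma>_eqI [OF T]) (simp_all add: star_i)
    qed (use x in \<open>simp_all add: ext_Gamma_def\<close>)
  qed (simp_all add: ext_Gamma_def)
  ultimately show ?thesis
    using center_extension_transversal.center_cocycle_ext [OF T] by simp
qed

section \<open>The obstruction to lifting a pair of automorphisms\<close>

text \<open>
  These are the representatives of \<open>\<chi>\<^sub>1(\<alpha>)\<close> for \<open>\<eta> = id\<close> and of \<open>\<chi>\<^sub>2(\<eta>)\<close> for \<open>\<alpha> = id\<close>.
\<close>

definition obstruction_f :: "('h \<Rightarrow> 'h) \<Rightarrow> ('k \<Rightarrow> 'k) \<Rightarrow> 'k \<times> 'k \<Rightarrow> 'h"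
  where "obstruction_f \<alpha> \<eta> =
    (\<lambda>(x, y)\<in>carrier K \<times> carrier K. f (\<eta> x, \<eta> y) \<otimes>\<^bsub>H\<^esub> inv\<^bsub>H\<^esub> (\<alpha> (f (x, y))))"

definition obstruction_h :: "('h \<Rightarrow> 'h) \<Rightarrow> ('k \<Rightarrow> 'k) \<Rightarrow> 'k \<times> 'k \<Rightarrow> 'h"
  where "obstruction_h \<alpha> \<eta> =
    (\<lambda>(x, y)\<in>carrier K \<times> carrier K. h (\<eta> x, \<eta> y) \<otimes>\<^bsub>H\<^esub> inv\<^bsub>H\<^esub> (\<alpha> (h (x, y))))"

text \<open>
  The obstruction is the quotient of the cocycle twisted by \<open>(id, \<eta>)\<close> by the one twisted by
  \<open>(\<alpha>, id)\<close>.
\<close>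

lemma center_cocycle_obstruction:
  assumes \<alpha>: "\<alpha> \<in> carrier (C1_L H K \<Gamma>)" and \<eta>: "\<eta> \<in> carrier (C2_L H K \<Gamma>)"
  shows "center_cocycle K H \<Gamma> (obstruction_f \<alpha> \<eta>) (obstruction_h \<alpha> \<eta>)"
proof -
  let ?f1 = "\<lambda>(x, y)\<in>carrier K \<times> carrier K. id_H (f (\<eta> x, \<eta> y))"
  let ?h1 = "\<lambda>(x, y)\<in>carrier K \<times> carrier K. id_H (h (\<eta> x, \<eta> y))"
  let ?f2 = "\<lambda>(x, y)\<in>carrier K \<times> carrier K. \<alpha> (f (id_K x, id_K y))"
  let ?h2 = "\<lambda>(x, y)\<in>carrier K \<times> carrier K. \<alpha> (h (id_K x, id_K y))"
  have "center_cocycle K H \<Gamma> (cmul ?f1 (cinv ?f2)) (cmul ?h1 (cinv ?h2))"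
    by (intro center_cocycle_mult center_cocycle_inv center_cocycle_twisted \<alpha> \<eta> id_C1 id_C2)
  moreover have "\<eta> x \<in> carrier K" if "x \<in> carrier K" for x
    using \<eta> that by (auto simp: C2_iff)
  then have "cmul ?f1 (cinv ?f2) = obstruction_f \<alpha> \<eta>" "cmul ?h1 (cinv ?h2) = obstruction_h \<alpha> \<eta>"
    unfolding obstruction_f_def obstruction_h_def by - (rule restrict_ext, clarsimp)+
  ultimately show ?thesis by simp
qed

definition lifts :: "('g \<Rightarrow> 'g) \<Rightarrow> ('h \<Rightarrow> 'h) \<Rightarrow> ('k \<Rightarrow> 'k) \<Rightarrow> bool"
  where "lifts \<phi> \<alpha> \<eta> \<longleftrightarrow> \<phi> \<in> mla_auto G \<and>
    (\<forall>a\<in>carrier H. \<phi> (i a) = i (\<alpha> a)) \<and> (\<forall>g\<in>carrier G. \<beta> (\<phi> g) = \<eta> (\<beta> g))"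

text \<open>
  The lift is \<open>elt a x \<mapsto> elt (\<alpha> a \<otimes> inv (lam x)) (\<eta> x)\<close>. Solved for the values of \<open>\<alpha>\<close>, the two
  coboundary equations say that this map preserves products and \<open>\<star>\<close>; it is bijective because \<open>\<alpha>\<close>
  and \<open>\<eta>\<close> are, and \<open>lam \<one> = \<one>\<close> makes it restrict to \<open>\<alpha>\<close> on \<open>H\<close>.
\<close>

lemma lifts_if_coboundary:
  assumes \<alpha>: "\<alpha> \<in> carrier (C1_L H K \<Gamma>)" and \<eta>: "\<eta> \<in> carrier (C2_L H K \<Gamma>)"
    and lam: "coboundary_by lam (obstruction_f \<alpha> \<eta>) (obstruction_h \<alpha> \<eta>)"
  shows "\<exists>\<phi>. lifts \<phi> \<alpha> \<eta>"
proof -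
  have \<alpha>_auto: "\<alpha> \<in> mla_auto H" and \<eta>_auto: "\<eta> \<in> mla_auto K"
    and \<alpha>_\<Gamma>: "\<And>x a. x \<in> carrier K \<Longrightarrow> a \<in> carrier H \<Longrightarrow> \<alpha> (\<Gamma> x a) = \<Gamma> x (\<alpha> a)"
    and \<eta>_\<Gamma>: "\<And>x a. x \<in> carrier K \<Longrightarrow> a \<in> carrier H \<Longrightarrow> \<Gamma> (\<eta> x) a = \<Gamma> x a"
    using \<alpha> \<eta> by (simp_all add: C1_iff C2_iff)
  note [simp] = mla_auto_closed [OF \<alpha>_auto] mla_auto_closed [OF \<eta>_auto]
  have [simp]: "lam x \<in> carrier H" if "x \<in> carrier K" for x
    using lam that by (auto simp: coboundary_by_def)
  have f_lam: "\<alpha> (f (x, y)) \<otimes>\<^bsub>H\<^esub> inv\<^bsub>H\<^esub> (lam (x \<otimes>\<^bsub>K\<^esub> y))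
      = inv\<^bsub>H\<^esub> (lam x) \<otimes>\<^bsub>H\<^esub> inv\<^bsub>H\<^esub> (lam y) \<otimes>\<^bsub>H\<^esub> f (\<eta> x, \<eta> y)"
    and h_lam: "\<alpha> (h (x, y)) \<otimes>\<^bsub>H\<^esub> inv\<^bsub>H\<^esub> (lam (x \<star>\<^bsub>K\<^esub> y))
      = inv\<^bsub>H\<^esub> (\<Gamma> x (lam y)) \<otimes>\<^bsub>H\<^esub> \<Gamma> y (lam x) \<otimes>\<^bsub>H\<^esub> h (\<eta> x, \<eta> y)"
    if "x \<in> carrier K" "y \<in> carrier K" for x y
  proof -
    have "f (\<eta> x, \<eta> y) \<otimes>\<^bsub>H\<^esub> inv\<^bsub>H\<^esub> (\<alpha> (f (x, y))) = lam x \<otimes>\<^bsub>H\<^esub> lam y \<otimes>\<^bsub>H\<^esub> inv\<^bsub>H\<^esub> (lam (x \<otimes>\<^bsub>K\<^esub> y))"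
      and "h (\<eta> x, \<eta> y) \<otimes>\<^bsub>H\<^esub> inv\<^bsub>H\<^esub> (\<alpha> (h (x, y)))
        = \<Gamma> x (lam y) \<otimes>\<^bsub>H\<^esub> \<Gamma> y (inv\<^bsub>H\<^esub> (lam x)) \<otimes>\<^bsub>H\<^esub> inv\<^bsub>H\<^esub> (lam (x \<star>\<^bsub>K\<^esub> y))"
      using lam that by (auto simp: coboundary_by_def obstruction_f_def obstruction_h_def)
    then show "\<alpha> (f (x, y)) \<otimes>\<^bsub>H\<^esub> inv\<^bsub>H\<^esub> (lam (x \<otimes>\<^bsub>K\<^esub> y))
      = inv\<^bsub>H\<^esub> (lam x) \<otimes>\<^bsub>H\<^esub> inv\<^bsub>H\<^esub> (lam y) \<otimes>\<^bsub>H\<^esub> f (\<eta> x, \<eta> y)"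
      and "\<alpha> (h (x, y)) \<otimes>\<^bsub>H\<^esub> inv\<^bsub>H\<^esub> (lam (x \<star>\<^bsub>K\<^esub> y))
      = inv\<^bsub>H\<^esub> (\<Gamma> x (lam y)) \<otimes>\<^bsub>H\<^esub> \<Gamma> y (lam x) \<otimes>\<^bsub>H\<^esub> h (\<eta> x, \<eta> y)"
      using that by (simp_all add: H.ratio_eq_iff \<Gamma>_inv)
  qed
  \<comment> \<open>The argument of \<open>\<alpha>\<close> is the \<open>H\<close>-coordinate of \<open>g\<close>.\<close>
  define \<phi> where "\<phi> = (\<lambda>g\<in>carrier G.
    elt (\<alpha> (inv_into (carrier H) i (g \<otimes>\<^bsub>G\<^esub> inv\<^bsub>G\<^esub> (t (\<beta> g)))) \<otimes>\<^bsub>H\<^esub> inv\<^bsub>H\<^esub> (lam (\<beta> g))) (\<eta> (\<beta> g)))"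
  have \<phi>_elt: "\<phi> (elt a x) = elt (\<alpha> a \<otimes>\<^bsub>H\<^esub> inv\<^bsub>H\<^esub> (lam x)) (\<eta> x)"
    if "a \<in> carrier H" "x \<in> carrier K" for a x
  proof -
    have "elt a x \<otimes>\<^bsub>G\<^esub> inv\<^bsub>G\<^esub> (t x) = i a"
      using that by (simp add: elt_def G.m_assoc)
    with that show ?thesis by (simp add: \<phi>_def inv_into_i)
  qed
  have "\<phi> \<in> extensional (carrier G)"
    by (simp add: \<phi>_def)
  moreover have "bij_betw \<phi> (carrier G) (carrier G)"
  proof (rule bij_betw_imageI)
    show "inj_on \<phi> (carrier G)"
    proof (rule inj_onI)
      fix g g' assume "g \<in> carrier G" "g' \<in> carrier G" "\<phi> g = \<phi> g'"
      then show "g = g'"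
        by (elim elt_exhaust)
          (auto simp: \<phi>_elt elt_eq_iff mla_auto_inj [OF \<alpha>_auto] mla_auto_inj [OF \<eta>_auto])
    qed
    show "\<phi> ` carrier G = carrier G"
    proof (intro equalityI subsetI)
      fix g assume "g \<in> \<phi> ` carrier G"
      then show "g \<in> carrier G" by (auto elim!: elt_exhaust simp: \<phi>_elt)
    next
      fix g assume "g \<in> carrier G"
      then obtain b y where b: "b \<in> carrier H" and y: "y \<in> carrier K" and g: "g = elt b y"
        by (rule elt_exhaust)
      obtain x where x: "x \<in> carrier K" "y = \<eta> x"
        using y mla_auto_image [OF \<eta>_auto] by blast
      then have "b \<otimes>\<^bsub>H\<^esub> lam x \<in> \<alpha> ` carrier H"
        using b mla_auto_image [OF \<alpha>_auto] by simp
      then obtain a where a: "a \<in> carrier H" "\<alpha> a = b \<otimes>\<^bsub>H\<^esub> lam x" by force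
      have "\<phi> (elt a x) = g"
        using a x b by (simp add: \<phi>_elt g H.m_assoc)
      with a x show "g \<in> \<phi> ` carrier G" by force
    qed
  qed
  moreover have "\<phi> (g \<otimes>\<^bsub>G\<^esub> g') = \<phi> g \<otimes>\<^bsub>G\<^esub> \<phi> g' \<and> \<phi> (g \<star>\<^bsub>G\<^esub> g') = \<phi> g \<star>\<^bsub>G\<^esub> \<phi> g'"
    if g: "g \<in> carrier G" and g': "g' \<in> carrier G" for g g'
  proof -
    obtain a x where [simp]: "a \<in> carrier H" "x \<in> carrier K" and g: "g = elt a x"
      using g by (rule elt_exhaust)
    obtain b y where [simp]: "b \<in> carrier H" "y \<in> carrier K" and g': "g' = elt b y"
      using g' by (rule elt_exhaust)
    have "\<phi> (g \<otimes>\<^bsub>G\<^esub> g') = elt (\<alpha> a \<otimes>\<^bsub>H\<^esub> \<alpha> b \<otimes>\<^bsub>H\<^esub> (\<alpha> (f (x, y)) \<otimes>\<^bsub>H\<^esub> inv\<^bsub>H\<^esub> (lam (x \<otimes>\<^bsub>K\<^esub> y)))) (\<eta> (x \<otimes>\<^bsub>K\<^esub> y))"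
      by (simp add: g g' elt_mult \<phi>_elt mla_auto_mult [OF \<alpha>_auto] H.m_assoc)
    also have "\<dots> = elt (\<alpha> a \<otimes>\<^bsub>H\<^esub> \<alpha> b \<otimes>\<^bsub>H\<^esub> (inv\<^bsub>H\<^esub> (lam x) \<otimes>\<^bsub>H\<^esub> inv\<^bsub>H\<^esub> (lam y) \<otimes>\<^bsub>H\<^esub> f (\<eta> x, \<eta> y)))
        (\<eta> x \<otimes>\<^bsub>K\<^esub> \<eta> y)"
      by (simp add: f_lam mla_auto_mult [OF \<eta>_auto])
    also have "\<dots> = \<phi> g \<otimes>\<^bsub>G\<^esub> \<phi> g'"
      by (simp add: g g' elt_mult \<phi>_elt elt_eq_iff H.m_ac)
    finally have 1: "\<phi> (g \<otimes>\<^bsub>G\<^esub> g') = \<phi> g \<otimes>\<^bsub>G\<^esub> \<phi> g'" .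
    have "\<phi> (g \<star>\<^bsub>G\<^esub> g') = elt (\<Gamma> x (\<alpha> b) \<otimes>\<^bsub>H\<^esub> \<Gamma> y (inv\<^bsub>H\<^esub> (\<alpha> a))
        \<otimes>\<^bsub>H\<^esub> (\<alpha> (h (x, y)) \<otimes>\<^bsub>H\<^esub> inv\<^bsub>H\<^esub> (lam (x \<star>\<^bsub>K\<^esub> y)))) (\<eta> (x \<star>\<^bsub>K\<^esub> y))"
      by (simp add: g g' elt_star \<phi>_elt mla_auto_mult [OF \<alpha>_auto] H.mla_auto_inv [OF \<alpha>_auto]
          \<alpha>_\<Gamma> H.m_assoc)
    also have "\<dots> = elt (\<Gamma> x (\<alpha> b) \<otimes>\<^bsub>H\<^esub> \<Gamma> y (inv\<^bsub>H\<^esub> (\<alpha> a))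
        \<otimes>\<^bsub>H\<^esub> (inv\<^bsub>H\<^esub> (\<Gamma> x (lam y)) \<otimes>\<^bsub>H\<^esub> \<Gamma> y (lam x) \<otimes>\<^bsub>H\<^esub> h (\<eta> x, \<eta> y))) (\<eta> x \<star>\<^bsub>K\<^esub> \<eta> y)"
      by (simp add: h_lam mla_auto_star [OF \<eta>_auto])
    also have "\<dots> = \<phi> g \<star>\<^bsub>G\<^esub> \<phi> g'"
      by (simp add: g g' elt_star \<phi>_elt elt_eq_iff \<eta>_\<Gamma> \<Gamma>_mult \<Gamma>_inv H.inv_mult H.m_ac)
    finally show ?thesis using 1 by simp
  qed
  ultimately have "\<phi> \<in> mla_auto G"
    unfolding mla_auto_iff by blast
  moreover have "\<phi> (i a) = i (\<alpha> a)" if "a \<in> carrier H" for a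
  proof -
    have "lam \<one>\<^bsub>K\<^esub> = \<one>\<^bsub>H\<^esub>" using lam by (simp add: coboundary_by_def)
    with that \<eta>_auto show ?thesis by (simp add: i_eq_elt \<phi>_elt)
  qed
  moreover have "\<beta> (\<phi> g) = \<eta> (\<beta> g)" if "g \<in> carrier G" for g
    using that by (rule elt_exhaust) (simp add: \<phi>_elt)
  ultimately show ?thesis unfolding lifts_def by blast
qed

text \<open>
  A lift sends \<open>t x\<close> into the fibre of \<open>\<beta>\<close> over \<open>\<eta> x\<close>, so it sends it to \<open>elt (m x) (\<eta> x)\<close> for some
  \<open>m x\<close>. Comparing the \<open>H\<close>-coordinates of the images of \<open>t x \<otimes> t y\<close> and \<open>t x \<star> t y\<close> exhibits the
  obstruction as the coboundary of \<open>x \<mapsto> inv (m x)\<close>.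
\<close>

lemma coboundary_if_lifts:
  assumes \<alpha>: "\<alpha> \<in> carrier (C1_L H K \<Gamma>)" and \<eta>: "\<eta> \<in> carrier (C2_L H K \<Gamma>)"
    and lifts: "lifts \<phi> \<alpha> \<eta>"
  shows "\<exists>lam. coboundary_by lam (obstruction_f \<alpha> \<eta>) (obstruction_h \<alpha> \<eta>)"
proof -
  have \<alpha>_auto: "\<alpha> \<in> mla_auto H" and \<eta>_auto: "\<eta> \<in> mla_auto K"
    and \<eta>_\<Gamma>: "\<And>x a. x \<in> carrier K \<Longrightarrow> a \<in> carrier H \<Longrightarrow> \<Gamma> (\<eta> x) a = \<Gamma> x a"
    using \<alpha> \<eta> by (simp_all add: C1_iff C2_iff)
  have \<phi>_auto: "\<phi> \<in> mla_auto G" and \<phi>_i: "\<And>a. a \<in> carrier H \<Longrightarrow> \<phi> (i a) = i (\<alpha> a)"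
    and \<beta>_\<phi>: "\<And>g. g \<in> carrier G \<Longrightarrow> \<beta> (\<phi> g) = \<eta> (\<beta> g)"
    using lifts by (auto simp: lifts_def)
  note [simp] = mla_auto_closed [OF \<alpha>_auto] mla_auto_closed [OF \<eta>_auto] mla_auto_closed [OF \<phi>_auto]
  have "\<exists>m. m \<in> carrier H \<and> \<phi> (t x) = elt m (\<eta> x)" if x: "x \<in> carrier K" for x
  proof -
    have "\<phi> (t x) \<in> carrier G" using x by simp
    then obtain m y where "m \<in> carrier H" "y \<in> carrier K" "\<phi> (t x) = elt m y"
      by (rule elt_exhaust)
    moreover from this have "y = \<eta> x"
      using \<beta>_\<phi> [of "t x"] x by simp
    ultimately show ?thesis by blast
  qed
  then obtain m where m [simp]: "\<And>x. x \<in> carrier K \<Longrightarrow> m x \<in> carrier H"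
    and \<phi>_t: "\<And>x. x \<in> carrier K \<Longrightarrow> \<phi> (t x) = elt (m x) (\<eta> x)"
    by metis
  have \<phi>_elt: "\<phi> (elt a x) = elt (\<alpha> a \<otimes>\<^bsub>H\<^esub> m x) (\<eta> x)" if "a \<in> carrier H" "x \<in> carrier K" for a x
  proof -
    have "\<phi> (elt a x) = i (\<alpha> a) \<otimes>\<^bsub>G\<^esub> elt (m x) (\<eta> x)"
      using that by (simp add: elt_def [of a] mla_auto_mult [OF \<phi>_auto] \<phi>_i \<phi>_t)
    then show ?thesis using that by (simp add: elt_def i_mult G.m_assoc)
  qed
  have "elt (m \<one>\<^bsub>K\<^esub>) \<one>\<^bsub>K\<^esub> = elt \<one>\<^bsub>H\<^esub> \<one>\<^bsub>K\<^esub>"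
    using \<phi>_t [of "\<one>\<^bsub>K\<^esub>"] \<phi>_auto \<eta>_auto by (simp add: elt_one)
  then have m_one: "m \<one>\<^bsub>K\<^esub> = \<one>\<^bsub>H\<^esub>"
    by (simp add: elt_eq_iff)
  have "coboundary_by (\<lambda>x. inv\<^bsub>H\<^esub> (m x)) (obstruction_f \<alpha> \<eta>) (obstruction_h \<alpha> \<eta>)"
    unfolding coboundary_by_def
  proof (intro conjI ballI)
    show "inv\<^bsub>H\<^esub> (m \<one>\<^bsub>K\<^esub>) = \<one>\<^bsub>H\<^esub>" by (simp add: m_one)
    fix x y assume [simp]: "x \<in> carrier K" "y \<in> carrier K"
    have "\<phi> (t x \<otimes>\<^bsub>G\<^esub> t y) = \<phi> (t x) \<otimes>\<^bsub>G\<^esub> \<phi> (t y)"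
      by (simp add: mla_auto_mult [OF \<phi>_auto])
    then have "\<alpha> (f (x, y)) \<otimes>\<^bsub>H\<^esub> m (x \<otimes>\<^bsub>K\<^esub> y) = m x \<otimes>\<^bsub>H\<^esub> m y \<otimes>\<^bsub>H\<^esub> f (\<eta> x, \<eta> y)"
      by (simp add: t_mult \<phi>_t elt_mult \<phi>_elt elt_eq_iff flip: elt_def)
    then show "obstruction_f \<alpha> \<eta> (x, y)
        = inv\<^bsub>H\<^esub> (m x) \<otimes>\<^bsub>H\<^esub> inv\<^bsub>H\<^esub> (m y) \<otimes>\<^bsub>H\<^esub> inv\<^bsub>H\<^esub> (inv\<^bsub>H\<^esub> (m (x \<otimes>\<^bsub>K\<^esub> y)))"
      unfolding obstruction_f_def
      using H.ratio_eq_iff [of "f (\<eta> x, \<eta> y)" "\<alpha> (f (x, y))" "inv\<^bsub>H\<^esub> (m x)" "inv\<^bsub>H\<^esub> (m y)"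
          "inv\<^bsub>H\<^esub> (m (x \<otimes>\<^bsub>K\<^esub> y))"] by simp
    have "\<phi> (t x \<star>\<^bsub>G\<^esub> t y) = \<phi> (t x) \<star>\<^bsub>G\<^esub> \<phi> (t y)"
      by (simp add: mla_auto_star [OF \<phi>_auto])
    then have "\<alpha> (h (x, y)) \<otimes>\<^bsub>H\<^esub> m (x \<star>\<^bsub>K\<^esub> y)
        = \<Gamma> x (m y) \<otimes>\<^bsub>H\<^esub> \<Gamma> y (inv\<^bsub>H\<^esub> (m x)) \<otimes>\<^bsub>H\<^esub> h (\<eta> x, \<eta> y)"
      by (simp add: t_star \<phi>_t elt_star \<phi>_elt elt_eq_iff \<eta>_\<Gamma> flip: elt_def)
    then show "obstruction_h \<alpha> \<eta> (x, y)
        = \<Gamma> x (inv\<^bsub>H\<^esub> (m y)) \<otimes>\<^bsub>H\<^esub> \<Gamma> y (inv\<^bsub>H\<^esub> (inv\<^bsub>H\<^esub> (m x))) \<otimes>\<^bsub>H\<^esub> inv\<^bsub>H\<^esub> (inv\<^bsub>H\<^esub> (m (x \<star>\<^bsub>K\<^esub> y)))"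
      unfolding obstruction_h_def
      using H.ratio_eq_iff [of "h (\<eta> x, \<eta> y)" "\<alpha> (h (x, y))" "inv\<^bsub>H\<^esub> (\<Gamma> x (m y))" "\<Gamma> y (m x)"
          "inv\<^bsub>H\<^esub> (m (x \<star>\<^bsub>K\<^esub> y))"] by (simp add: \<Gamma>_inv)
  qed simp
  then show ?thesis by blast
qed

end

section \<open>The two exact sequences\<close>

lemma Aut_on_cong:
  "(\<And>\<phi>. \<phi> \<in> mla_auto L \<Longrightarrow> P \<phi> \<longleftrightarrow> Q \<phi>) \<Longrightarrow> Aut_on L P = Aut_on L Q"
  unfolding Aut_on_def by (metis (mono_tags, lifting) Collect_cong)

context center_extension_transversal
begin

lemma fixes_K_iff:
  assumes "\<phi> \<in> mla_auto G" "g \<in> carrier G"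
  shows "\<phi> g \<otimes>\<^bsub>G\<^esub> inv\<^bsub>G\<^esub> g \<in> i ` carrier H \<longleftrightarrow> \<beta> (\<phi> g) = \<beta> g"
proof -
  have "\<phi> g \<in> carrier G" using assms by blast
  then show ?thesis
    using assms by (simp add: image_i_iff \<beta>_mult \<beta>_inv K.inv_solve_right')
qed

lemma Aut_fix_H_K_eq:
  "Aut_fix_H_K H G i = Aut_on G (\<lambda>\<phi>.
    (\<forall>a\<in>carrier H. \<phi> (i a) = i a) \<and> (\<forall>g\<in>carrier G. \<beta> (\<phi> g) = \<beta> g))"
  unfolding Aut_fix_H_K_def by (rule Aut_on_cong) (simp add: fixes_K_iff)

text \<open>
  An automorphism that commutes with \<open>\<beta>\<close> maps the kernel of \<open>\<beta>\<close>, which is \<open>i(H)\<close>, onto itself.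
\<close>

lemma Aut_stab_H_fix_K_eq:
  "Aut_stab_H_fix_K H G i = Aut_on G (\<lambda>\<phi>. \<forall>g\<in>carrier G. \<beta> (\<phi> g) = \<beta> g)"
  unfolding Aut_stab_H_fix_K_def
proof (rule Aut_on_cong)
  fix \<phi> assume \<phi>: "\<phi> \<in> mla_auto G"
  have "\<phi> ` i ` carrier H = i ` carrier H" if \<beta>_\<phi>: "\<forall>g\<in>carrier G. \<beta> (\<phi> g) = \<beta> g"
  proof (intro equalityI subsetI)
    fix g assume "g \<in> \<phi> ` i ` carrier H"
    then obtain a where "a \<in> carrier H" "g = \<phi> (i a)" by blast
    with \<beta>_\<phi> \<phi> show "g \<in> i ` carrier H" by (auto simp: image_i_iff)
  next
    fix g assume g: "g \<in> i ` carrier H"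
    then obtain g' where "g' \<in> carrier G" "g = \<phi> g'"
      using mla_auto_image [OF \<phi>] image_i_iff by blast
    with \<beta>_\<phi> g show "g \<in> \<phi> ` i ` carrier H" by (auto simp: image_i_iff)
  qed
  then show "\<phi> ` i ` carrier H = i ` carrier H \<and>
      (\<forall>g\<in>carrier G. \<phi> g \<otimes>\<^bsub>G\<^esub> inv\<^bsub>G\<^esub> g \<in> i ` carrier H)
    \<longleftrightarrow> (\<forall>g\<in>carrier G. \<beta> (\<phi> g) = \<beta> g)"
    using \<phi> by (auto simp: fixes_K_iff)
qed

lemma group_fix_H: "group (Aut_fix_H H G i)"
  unfolding Aut_fix_H_def by (rule G.group_Aut_on) (auto simp: compose_eq, metis i_closed)

lemma group_fix_K: "group (Aut_stab_H_fix_K H G i)"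
  unfolding Aut_stab_H_fix_K_eq
  by (rule G.group_Aut_on) (auto simp: compose_eq mla_auto_closed, metis mla_auto_closed)

lemma group_fix_H_K: "group (Aut_fix_H_K H G i)"
  unfolding Aut_fix_H_K_eq
  by (rule G.group_Aut_on)
    (auto simp: compose_eq mla_auto_closed, (metis i_closed mla_auto_closed)+)

lemma fix_K_inverse:
  assumes "\<phi> \<in> mla_auto G" "\<forall>g\<in>carrier G. \<beta> (\<phi> g) = \<beta> g"
  obtains \<psi> where "\<psi> \<in> mla_auto G" "\<forall>g\<in>carrier G. \<beta> (\<psi> g) = \<beta> g"
    and "\<forall>g\<in>carrier G. \<phi> (\<psi> g) = g \<and> \<psi> (\<phi> g) = g"
proof -
  obtain \<psi> where \<psi>: "\<psi> \<in> mla_auto G"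
    and inv: "\<And>g. g \<in> carrier G \<Longrightarrow> \<phi> (\<psi> g) = g" "\<And>g. g \<in> carrier G \<Longrightarrow> \<psi> (\<phi> g) = g"
    using G.mla_auto_inverse [OF assms(1)] by blast
  moreover have "\<beta> (\<psi> g) = \<beta> g" if "g \<in> carrier G" for g
    using assms inv \<psi> that by (metis mla_auto_closed)
  ultimately show ?thesis using that by blast
qed

lemma Pi1_apply:
  assumes "\<phi> \<in> mla_auto G" "\<forall>g\<in>carrier G. \<beta> (\<phi> g) = \<beta> g" "a \<in> carrier H"
  shows "Pi1 H i \<phi> a \<in> carrier H" "i (Pi1 H i \<phi> a) = \<phi> (i a)"
proof -
  have "\<phi> (i a) \<in> carrier G" "\<beta> (\<phi> (i a)) = \<one>\<^bsub>K\<^esub>"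
    using assms by auto
  then show "Pi1 H i \<phi> a \<in> carrier H" "i (Pi1 H i \<phi> a) = \<phi> (i a)"
    using assms by (simp_all add: Pi1_def inv_into_closed i_inv_into)
qed

lemma Pi1_eqI:
  "\<lbrakk>\<alpha> \<in> extensional (carrier H); \<And>a. a \<in> carrier H \<Longrightarrow> \<alpha> a \<in> carrier H \<and> \<phi> (i a) = i (\<alpha> a)\<rbrakk>
    \<Longrightarrow> Pi1 H i \<phi> = \<alpha>"
  by (rule extensionalityI [of _ "carrier H"]) (auto simp: Pi1_def inv_into_i)

text \<open>
  The inverse of \<open>\<phi>\<close> also preserves the fibres of \<open>\<beta>\<close>, and its restriction to \<open>H\<close> inverts that of
  \<open>\<phi>\<close>. The restriction commutes with \<open>\<Gamma> x\<close> since \<open>\<phi> (t x)\<close> is a central multiple of \<open>t x\<close> and so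
  acts on \<open>H\<close> as \<open>t x\<close> does.
\<close>

lemma Pi1_C1:
  assumes \<phi>: "\<phi> \<in> mla_auto G" and fixed: "\<forall>g\<in>carrier G. \<beta> (\<phi> g) = \<beta> g"
  shows "Pi1 H i \<phi> \<in> carrier (C1_L H K \<Gamma>)"
proof -
  note P [simp] = Pi1_apply [OF \<phi> fixed]
  obtain \<psi> where \<psi>: "\<psi> \<in> mla_auto G" "\<forall>g\<in>carrier G. \<beta> (\<psi> g) = \<beta> g"
    and inv: "\<forall>g\<in>carrier G. \<phi> (\<psi> g) = g \<and> \<psi> (\<phi> g) = g"
    using fix_K_inverse [OF \<phi> fixed] by blast
  note Q [simp] = Pi1_apply [OF \<psi>]
  have eq: "Pi1 H i \<phi> a = b" if "a \<in> carrier H" "b \<in> carrier H" "\<phi> (i a) = i b" for a b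
    using that by (simp flip: i_eq_iff)
  have eq': "Pi1 H i \<psi> a = b" if "a \<in> carrier H" "b \<in> carrier H" "\<psi> (i a) = i b" for a b
    using that by (simp flip: i_eq_iff)
  have "bij_betw (Pi1 H i \<phi>) (carrier H) (carrier H)"
    by (rule bij_betw_byWitness [where f' = "Pi1 H i \<psi>"]) (use inv in \<open>auto intro!: eq eq'\<close>)
  moreover have "Pi1 H i \<phi> (a \<otimes>\<^bsub>H\<^esub> b) = Pi1 H i \<phi> a \<otimes>\<^bsub>H\<^esub> Pi1 H i \<phi> b"
    "Pi1 H i \<phi> (a \<star>\<^bsub>H\<^esub> b) = Pi1 H i \<phi> a \<star>\<^bsub>H\<^esub> Pi1 H i \<phi> b"
    if "a \<in> carrier H" "b \<in> carrier H" for a b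
    using that \<phi> by (auto intro!: eq simp: i_mult mla_auto_mult star_H)
  moreover have "Pi1 H i \<phi> \<in> extensional (carrier H)"
    by (simp add: Pi1_def)
  ultimately have "Pi1 H i \<phi> \<in> mla_auto H"
    by (simp add: mla_auto_iff)
  moreover have "Pi1 H i \<phi> (\<Gamma> x a) = \<Gamma> x (Pi1 H i \<phi> a)"
    if xa [simp]: "x \<in> carrier K" "a \<in> carrier H" for x a
  proof (rule eq)
    obtain b y where b [simp]: "b \<in> carrier H" "y \<in> carrier K" and t: "\<phi> (t x) = elt b y"
      using mla_auto_closed [OF \<phi> t_closed [OF xa(1)]] by (rule elt_exhaust)
    then have "y = \<beta> (\<phi> (t x))" by simp
    also have "\<dots> = x" using fixed by simp
    finally have "y = x" .
    have "\<phi> (i (\<Gamma> x a)) = \<phi> (t x) \<star>\<^bsub>G\<^esub> \<phi> (i a)"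
      using \<phi> by (simp add: mla_auto_star flip: star_i)
    also have "\<phi> (i a) = elt (Pi1 H i \<phi> a) \<one>\<^bsub>K\<^esub>"
      by (simp flip: i_eq_elt)
    also have "\<phi> (t x) \<star>\<^bsub>G\<^esub> elt (Pi1 H i \<phi> a) \<one>\<^bsub>K\<^esub> = i (\<Gamma> x (Pi1 H i \<phi> a))"
      by (simp add: t \<open>y = x\<close> elt_star i_eq_elt h_one_right)
    finally show "\<phi> (i (\<Gamma> x a)) = i (\<Gamma> x (Pi1 H i \<phi> a))" .
  qed simp_all
  ultimately show ?thesis by (simp add: C1_iff)
qed

text \<open>
  An automorphism that fixes \<open>H\<close> pointwise maps each coset of \<open>i(H)\<close> to a coset, so the map it
  induces on \<open>K\<close> can be computed with any representative in place of \<open>t x\<close>.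
\<close>

lemma Pi2_apply:
  assumes \<phi>: "\<phi> \<in> mla_auto G" and fixed: "\<forall>a\<in>carrier H. \<phi> (i a) = i a" and g: "g \<in> carrier G"
  shows "Pi2 K \<beta> t \<phi> (\<beta> g) = \<beta> (\<phi> g)"
proof -
  obtain a x where ax: "a \<in> carrier H" "x \<in> carrier K" "g = elt a x"
    using g by (rule elt_exhaust)
  then have "\<phi> g = i a \<otimes>\<^bsub>G\<^esub> \<phi> (t x)"
    using \<phi> fixed by (simp add: elt_def mla_auto_mult)
  with ax \<phi> show ?thesis by (simp add: Pi2_def \<beta>_mult mla_auto_closed)
qed

lemma Pi2_eqI:
  assumes "\<eta> \<in> extensional (carrier K)" "\<And>g. g \<in> carrier G \<Longrightarrow> \<beta> (\<phi> g) = \<eta> (\<beta> g)"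
  shows "Pi2 K \<beta> t \<phi> = \<eta>"
  by (rule extensionalityI [of _ "carrier K"]) (use assms in \<open>auto simp: Pi2_def\<close>)

text \<open>
  The inverse of \<open>\<phi>\<close> also fixes \<open>H\<close>, and the map it induces inverts the one induced by \<open>\<phi>\<close>. The
  elements \<open>t x\<close> and \<open>\<phi> (t x)\<close> act in the same way on \<open>H\<close>, because
  \<open>\<phi> (t x) \<star> i a = \<phi> (t x \<star> i a)\<close> and \<open>\<phi>\<close> fixes the element \<open>t x \<star> i a\<close> of \<open>i(H)\<close>.
\<close>

lemma Pi2_C2:
  assumes \<phi>: "\<phi> \<in> mla_auto G" and fixed: "\<forall>a\<in>carrier H. \<phi> (i a) = i a"
  shows "Pi2 K \<beta> t \<phi> \<in> carrier (C2_L H K \<Gamma>)"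
proof -
  note P = Pi2_apply [OF \<phi> fixed]
  obtain \<psi> where \<psi>: "\<psi> \<in> mla_auto G"
    and inv: "\<And>g. g \<in> carrier G \<Longrightarrow> \<phi> (\<psi> g) = g" "\<And>g. g \<in> carrier G \<Longrightarrow> \<psi> (\<phi> g) = g"
    using G.mla_auto_inverse [OF \<phi>] by blast
  have "\<forall>a\<in>carrier H. \<psi> (i a) = i a"
    using fixed inv by (metis i_closed)
  note Q = Pi2_apply [OF \<psi> this]
  note [simp] = mla_auto_closed [OF \<phi>] mla_auto_closed [OF \<psi>]
  have surj: "\<exists>g. g \<in> carrier G \<and> x = \<beta> g" if "x \<in> carrier K" for x
    using that \<beta>_surj by blast
  have "bij_betw (Pi2 K \<beta> t \<phi>) (carrier K) (carrier K)"
    by (rule bij_betw_byWitness [where f' = "Pi2 K \<beta> t \<psi>"])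
      (auto dest!: surj simp: P Q inv)
  moreover have "Pi2 K \<beta> t \<phi> (x \<otimes>\<^bsub>K\<^esub> y) = Pi2 K \<beta> t \<phi> x \<otimes>\<^bsub>K\<^esub> Pi2 K \<beta> t \<phi> y \<and>
      Pi2 K \<beta> t \<phi> (x \<star>\<^bsub>K\<^esub> y) = Pi2 K \<beta> t \<phi> x \<star>\<^bsub>K\<^esub> Pi2 K \<beta> t \<phi> y"
    if xy: "x \<in> carrier K" "y \<in> carrier K" for x y
  proof -
    obtain g where g: "g \<in> carrier G" "x = \<beta> g"
      using surj [OF xy(1)] by blast
    obtain g' where g': "g' \<in> carrier G" "y = \<beta> g'"
      using surj [OF xy(2)] by blast
    from g g' show ?thesis
      by (simp add: P mla_auto_mult [OF \<phi>] mla_auto_star [OF \<phi>] flip: \<beta>_mult \<beta>_star)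
  qed
  moreover have "Pi2 K \<beta> t \<phi> \<in> extensional (carrier K)"
    by (simp add: Pi2_def)
  ultimately have "Pi2 K \<beta> t \<phi> \<in> mla_auto K"
    unfolding mla_auto_iff by blast
  moreover have "\<Gamma> (Pi2 K \<beta> t \<phi> x) a = \<Gamma> x a"
    if xa [simp]: "x \<in> carrier K" "a \<in> carrier H" for x a
  proof -
    obtain b y where b [simp]: "b \<in> carrier H" "y \<in> carrier K" and t: "\<phi> (t x) = elt b y"
      using mla_auto_closed [OF \<phi> t_closed [OF xa(1)]] by (rule elt_exhaust)
    have "i (\<Gamma> x a) = \<phi> (t x \<star>\<^bsub>G\<^esub> i a)"
      using fixed by (simp add: star_i)
    also have "\<dots> = elt b y \<star>\<^bsub>G\<^esub> i a"
      using fixed by (simp add: mla_auto_star [OF \<phi>] t)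
    also have "\<dots> = i (\<Gamma> y a)"
      by (simp add: elt_star i_eq_elt h_one_right)
    finally have "\<Gamma> x a = \<Gamma> y a" by simp
    moreover have "Pi2 K \<beta> t \<phi> x = y" by (simp add: Pi2_def t)
    ultimately show ?thesis by simp
  qed
  ultimately show ?thesis by (simp add: C2_iff)
qed

lemma chi1_eq: "chi1 H G K i t \<alpha> = H2_class K H \<Gamma> (obstruction_f \<alpha> id_K) (obstruction_h \<alpha> id_K)"
proof -
  have "(\<lambda>p\<in>carrier K \<times> carrier K. f p \<otimes>\<^bsub>H\<^esub> inv\<^bsub>H\<^esub> (\<alpha> (f p))) = obstruction_f \<alpha> id_K"
    "(\<lambda>p\<in>carrier K \<times> carrier K. h p \<otimes>\<^bsub>H\<^esub> inv\<^bsub>H\<^esub> (\<alpha> (h p))) = obstruction_h \<alpha> id_K"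
    unfolding obstruction_f_def obstruction_h_def by - (rule restrict_ext, clarsimp)+
  then show ?thesis by (simp add: chi1_def)
qed

lemma chi2_eq: "chi2 H G K i t \<eta> = H2_class K H \<Gamma> (obstruction_f id_H \<eta>) (obstruction_h id_H \<eta>)"
proof -
  have "(\<lambda>(x, y)\<in>carrier K \<times> carrier K. f (\<eta> x, \<eta> y) \<otimes>\<^bsub>H\<^esub> inv\<^bsub>H\<^esub> (f (x, y))) = obstruction_f id_H \<eta>"
    "(\<lambda>(x, y)\<in>carrier K \<times> carrier K. h (\<eta> x, \<eta> y) \<otimes>\<^bsub>H\<^esub> inv\<^bsub>H\<^esub> (h (x, y))) = obstruction_h id_H \<eta>"
    unfolding obstruction_f_def obstruction_h_def by - (rule restrict_ext, clarsimp)+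
  then show ?thesis by (simp add: chi2_def)
qed

lemma obstruction_trivial_iff:
  assumes "\<alpha> \<in> carrier (C1_L H K \<Gamma>)" "\<eta> \<in> carrier (C2_L H K \<Gamma>)"
  shows "H2_class K H \<Gamma> (obstruction_f \<alpha> \<eta>) (obstruction_h \<alpha> \<eta>) = \<one>\<^bsub>H2_ML K H \<Gamma>\<^esub>
    \<longleftrightarrow> (\<exists>\<phi>. lifts \<phi> \<alpha> \<eta>)"
  using H2_class_trivial_iff [OF center_cocycle_obstruction [OF assms]]
    lifts_if_coboundary [OF assms] coboundary_if_lifts [OF assms] by blast

lemma exact_sequence_Pi1:
  "exact_sequence (Aut_fix_H_K H G i) (\<lambda>\<phi>. \<phi>) (Aut_stab_H_fix_K H G i)
    (Pi1 H i) (C1_L H K \<Gamma>) (chi1 H G K i t) (H2_ML K H \<Gamma>)"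
  unfolding exact_sequence_def
proof (intro conjI)
  let ?A = "Aut_fix_H_K H G i" and ?B = "Aut_stab_H_fix_K H G i" and ?C = "C1_L H K \<Gamma>"
  show "group_hom ?A ?B (\<lambda>\<phi>. \<phi>)"
    by (intro group_hom.intro group_hom_axioms.intro group_fix_H_K group_fix_K)
      (auto simp: hom_def Aut_fix_H_K_eq Aut_stab_H_fix_K_eq mult_Aut_on)
  have "Pi1 H i (compose (carrier G) \<phi> \<psi>) = compose (carrier H) (Pi1 H i \<phi>) (Pi1 H i \<psi>)"
    if "\<phi> \<in> carrier ?B" "\<psi> \<in> carrier ?B" for \<phi> \<psi>
    using that by (intro Pi1_eqI) (auto simp: Aut_stab_H_fix_K_eq compose_eq Pi1_apply)
  then have "Pi1 H i \<in> hom ?B ?C"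
    using Pi1_C1 C1_iff
    by (auto simp: hom_def Aut_stab_H_fix_K_eq C1_L_def mult_Aut_on)
  then show "group_hom ?B ?C (Pi1 H i)"
    by (intro group_hom.intro group_hom_axioms.intro group_fix_K group_C1)
  show "group (H2_ML K H \<Gamma>)" by (rule group_H2)
  show "chi1 H G K i t \<in> carrier ?C \<rightarrow> carrier (H2_ML K H \<Gamma>)"
    by (simp add: chi1_eq H2_class_closed center_cocycle_obstruction id_C2)
  show "kernel ?A ?B (\<lambda>\<phi>. \<phi>) = {\<one>\<^bsub>?A\<^esub>}"
    using group.is_monoid [OF group_fix_H_K, THEN monoid.one_closed]
    by (auto simp: kernel_def Aut_fix_H_K_eq Aut_stab_H_fix_K_eq)
  have "Pi1 H i \<phi> = id_H \<longleftrightarrow> (\<forall>a\<in>carrier H. \<phi> (i a) = i a)" if "\<phi> \<in> carrier ?B" for \<phi>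
  proof
    assume "Pi1 H i \<phi> = id_H"
    then show "\<forall>a\<in>carrier H. \<phi> (i a) = i a"
      using that Pi1_apply(2) [of \<phi>] by (auto simp: Aut_stab_H_fix_K_eq)
  qed (auto intro: Pi1_eqI)
  then show "(\<lambda>\<phi>. \<phi>) ` carrier ?A = kernel ?B ?C (Pi1 H i)"
    by (auto simp: kernel_def Aut_fix_H_K_eq Aut_stab_H_fix_K_eq C1_L_def)
  show "Pi1 H i ` carrier ?B = kernel ?C (H2_ML K H \<Gamma>) (chi1 H G K i t)"
  proof (intro equalityI subsetI)
    fix \<alpha> assume "\<alpha> \<in> Pi1 H i ` carrier ?B"
    then obtain \<phi> where \<phi>: "\<phi> \<in> mla_auto G" "\<forall>g\<in>carrier G. \<beta> (\<phi> g) = \<beta> g" "\<alpha> = Pi1 H i \<phi>"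
      by (auto simp: Aut_stab_H_fix_K_eq)
    then have "\<alpha> \<in> carrier ?C" "lifts \<phi> \<alpha> id_K"
      by (simp_all add: Pi1_C1 lifts_def Pi1_apply)
    then show "\<alpha> \<in> kernel ?C (H2_ML K H \<Gamma>) (chi1 H G K i t)"
      using obstruction_trivial_iff [OF _ id_C2] by (auto simp: kernel_def chi1_eq)
  next
    fix \<alpha> assume \<alpha>: "\<alpha> \<in> kernel ?C (H2_ML K H \<Gamma>) (chi1 H G K i t)"
    then obtain \<phi> where \<phi>: "lifts \<phi> \<alpha> id_K"
      using obstruction_trivial_iff [OF _ id_C2] by (auto simp: kernel_def chi1_eq)
    have "\<alpha> \<in> mla_auto H" using \<alpha> by (simp add: kernel_def C1_iff)
    then have "Pi1 H i \<phi> = \<alpha>"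
      using \<phi> by (intro Pi1_eqI) (auto simp: lifts_def mla_auto_iff bij_betw_def)
    moreover have "\<phi> \<in> carrier ?B"
      using \<phi> by (simp add: lifts_def Aut_stab_H_fix_K_eq)
    ultimately show "\<alpha> \<in> Pi1 H i ` carrier ?B" by blast
  qed
qed

lemma exact_sequence_Pi2:
  "exact_sequence (Aut_fix_H_K H G i) (\<lambda>\<phi>. \<phi>) (Aut_fix_H H G i)
    (Pi2 K \<beta> t) (C2_L H K \<Gamma>) (chi2 H G K i t) (H2_ML K H \<Gamma>)"
  unfolding exact_sequence_def
proof (intro conjI)
  let ?A = "Aut_fix_H_K H G i" and ?B = "Aut_fix_H H G i" and ?C = "C2_L H K \<Gamma>"
  show "group_hom ?A ?B (\<lambda>\<phi>. \<phi>)"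
    by (intro group_hom.intro group_hom_axioms.intro group_fix_H_K group_fix_H)
      (auto simp: hom_def Aut_fix_H_K_eq Aut_fix_H_def mult_Aut_on)
  have "Pi2 K \<beta> t (compose (carrier G) \<phi> \<psi>) = compose (carrier K) (Pi2 K \<beta> t \<phi>) (Pi2 K \<beta> t \<psi>)"
    if "\<phi> \<in> carrier ?B" "\<psi> \<in> carrier ?B" for \<phi> \<psi>
    using that by (intro Pi2_eqI) (auto simp: Aut_fix_H_def compose_eq Pi2_apply mla_auto_closed)
  then have "Pi2 K \<beta> t \<in> hom ?B ?C"
    using Pi2_C2 C2_iff
    by (auto simp: hom_def Aut_fix_H_def C2_L_def mult_Aut_on)
  then show "group_hom ?B ?C (Pi2 K \<beta> t)"
    by (intro group_hom.intro group_hom_axioms.intro group_fix_H group_C2)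
  show "group (H2_ML K H \<Gamma>)" by (rule group_H2)
  show "chi2 H G K i t \<in> carrier ?C \<rightarrow> carrier (H2_ML K H \<Gamma>)"
    by (simp add: chi2_eq H2_class_closed center_cocycle_obstruction id_C1)
  show "kernel ?A ?B (\<lambda>\<phi>. \<phi>) = {\<one>\<^bsub>?A\<^esub>}"
    using group.is_monoid [OF group_fix_H_K, THEN monoid.one_closed]
    by (auto simp: kernel_def Aut_fix_H_K_eq Aut_fix_H_def)
  have "Pi2 K \<beta> t \<phi> = id_K \<longleftrightarrow> (\<forall>g\<in>carrier G. \<beta> (\<phi> g) = \<beta> g)" if "\<phi> \<in> carrier ?B" for \<phi>
  proof
    assume "Pi2 K \<beta> t \<phi> = id_K"
    then show "\<forall>g\<in>carrier G. \<beta> (\<phi> g) = \<beta> g"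
      using that Pi2_apply [of \<phi>] by (auto simp: Aut_fix_H_def)
  qed (auto intro: Pi2_eqI)
  then show "(\<lambda>\<phi>. \<phi>) ` carrier ?A = kernel ?B ?C (Pi2 K \<beta> t)"
    by (auto simp: kernel_def Aut_fix_H_K_eq Aut_fix_H_def C2_L_def)
  show "Pi2 K \<beta> t ` carrier ?B = kernel ?C (H2_ML K H \<Gamma>) (chi2 H G K i t)"
  proof (intro equalityI subsetI)
    fix \<eta> assume "\<eta> \<in> Pi2 K \<beta> t ` carrier ?B"
    then obtain \<phi> where \<phi>: "\<phi> \<in> mla_auto G" "\<forall>a\<in>carrier H. \<phi> (i a) = i a" "\<eta> = Pi2 K \<beta> t \<phi>"
      by (auto simp: Aut_fix_H_def)
    then have "\<eta> \<in> carrier ?C" "lifts \<phi> id_H \<eta>"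
      by (simp_all add: Pi2_C2 lifts_def Pi2_apply)
    then show "\<eta> \<in> kernel ?C (H2_ML K H \<Gamma>) (chi2 H G K i t)"
      using obstruction_trivial_iff [OF id_C1] by (auto simp: kernel_def chi2_eq)
  next
    fix \<eta> assume \<eta>: "\<eta> \<in> kernel ?C (H2_ML K H \<Gamma>) (chi2 H G K i t)"
    then obtain \<phi> where \<phi>: "lifts \<phi> id_H \<eta>"
      using obstruction_trivial_iff [OF id_C1] by (auto simp: kernel_def chi2_eq)
    have "\<eta> \<in> mla_auto K" using \<eta> by (simp add: kernel_def C2_iff)
    then have "Pi2 K \<beta> t \<phi> = \<eta>"
      using \<phi> by (intro Pi2_eqI) (auto simp: lifts_def mla_auto_iff)
    moreover have "\<phi> \<in> carrier ?B"
      using \<phi> by (simp add: lifts_def Aut_fix_H_def)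
    ultimately show "\<eta> \<in> Pi2 K \<beta> t ` carrier ?B" by blast
  qed
qed

end

theorem theorem3p3:
  fixes H :: "('h, 'l) mla_scheme" and G :: "('g, 'm) mla_scheme" and K :: "('k, 'n) mla_scheme"
    and i :: "'h \<Rightarrow> 'g" and \<beta> :: "'g \<Rightarrow> 'k" and t :: "'k \<Rightarrow> 'g"
  assumes "center_extension H G K i \<beta>"
    and "transversal G K \<beta> t"
  shows "exact_sequence (Aut_fix_H_K H G i) (\<lambda>\<phi>. \<phi>) (Aut_stab_H_fix_K H G i)
           (Pi1 H i) (C1_L H K (ext_Gamma H G K i t)) (chi1 H G K i t)
           (H2_ML K H (ext_Gamma H G K i t))
       \<and> exact_sequence (Aut_fix_H_K H G i) (\<lambda>\<phi>. \<phi>) (Aut_fix_H H G i)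
           (Pi2 K \<beta> t) (C2_L H K (ext_Gamma H G K i t)) (chi2 H G K i t)
           (H2_ML K H (ext_Gamma H G K i t))"
proof -
  interpret center_extension_transversal H G K i \<beta> t
    using assms by (intro center_extension_transversal.intro center_extension_transversal_axioms.intro)
  show ?thesis
    using exact_sequence_Pi1 exact_sequence_Pi2 by blast
qed

end
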